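(* Let $\mu\in\mathbb{R}$, $\tau>0$, $\sigma>0$, and let $V\sim\mathcal N(\mu,\tau^2)$ and $U\sim\mathcal N(0,\sigma^2)$ be independent random variables. Let $\phi,P\colon\mathbb{R}\to\mathbb{R}$ be Borel measurable and set $Y_\phi=\phi(V)+U$. If $(\phi,P)$ is a quasi-equilibrium, then $$\phi(v)=\frac{\sigma}{\tau}(v-\mu)\qquad\text{for Lebesgue-almost every }v\in\mathbb{R},$$ and $$P(Y_\phi)=\mu+\lambda Y_\phi\qquad\text{almost surely},$$ where $$\lambda=\frac{\operatorname{Cov}(V,Y_\phi)}{\operatorname{Var}(Y_\phi)}=\frac{\tau}{2\sigma}.$$
   Context: A pair $(\phi,P)$ of Borel-measurable functions $\mathbb{R}\to\mathbb{R}$ is a quasi-equilibrium if the following two conditions hold. (1) Almost everywhere profit maximisation: for Lebesgue-almost every $v\in\mathbb{R}$, $$\mathbb{E}\big[(v-P(\phi(v)+U))\,\phi(v)\big]\ \ge\ \mathbb{E}\big[(v-P(x+U))\,x\big]\qquad\text{for every }x\in\mathbb{R}.$$ (2) Market efficiency: $P(Y_\phi)=\mathbb{E}[V\mid Y_\phi]$ almost surely, where $Y_\phi=\phi(V)+U$. No integrability of $\phi(V)$ is assumed. Whenever (2) holds, $P(x+U)$ is integrable for every $x\in\mathbb{R}$, so the expectations in (1) are well defined and finite. *)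

theory Defs
  imports "HOL-Probability.Probability"
begin

definition covariance :: "'a measure \<Rightarrow> ('a \<Rightarrow> real) \<Rightarrow> ('a \<Rightarrow> real) \<Rightarrow> real" where
  "covariance M X Y =
     (\<integral>\<omega>. (X \<omega> - (\<integral>\<omega>'. X \<omega>' \<partial>M)) * (Y \<omega> - (\<integral>\<omega>'. Y \<omega>' \<partial>M)) \<partial>M)"

definition order_flow ::
    "('a \<Rightarrow> real) \<Rightarrow> ('a \<Rightarrow> real) \<Rightarrow> (real \<Rightarrow> real) \<Rightarrow> 'a \<Rightarrow> real" where
  "order_flow V U \<phi> \<omega> = \<phi> (V \<omega>) + U \<omega>"

definition expected_profit ::
    "'a measure \<Rightarrow> ('a \<Rightarrow> real) \<Rightarrow> (real \<Rightarrow> real) \<Rightarrow> real \<Rightarrow> real \<Rightarrow> real" where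
  "expected_profit M U P v x = (\<integral>\<omega>. (v - P (x + U \<omega>)) * x \<partial>M)"

definition ae_profit_maximising ::
    "'a measure \<Rightarrow> ('a \<Rightarrow> real) \<Rightarrow> (real \<Rightarrow> real) \<Rightarrow> (real \<Rightarrow> real) \<Rightarrow> bool" where
  "ae_profit_maximising M U \<phi> P \<longleftrightarrow>
     (AE v in lborel. \<forall>x. expected_profit M U P v (\<phi> v) \<ge> expected_profit M U P v x)"

definition market_efficient ::
    "'a measure \<Rightarrow> ('a \<Rightarrow> real) \<Rightarrow> ('a \<Rightarrow> real) \<Rightarrow> (real \<Rightarrow> real) \<Rightarrow> (real \<Rightarrow> real) \<Rightarrow> bool" where
  "market_efficient M V U \<phi> P \<longleftrightarrow>
     (AE \<omega> in M. P (order_flow V U \<phi> \<omega>) =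
        real_cond_exp M (vimage_algebra (space M) (order_flow V U \<phi>) borel) V \<omega>)"

(* No integrability is required of "\<phi> (V \<omega>)" or of "P (x + U \<omega>)".  For Gaussian V and U as
   in the model, market efficiency already makes every "P (x + U \<omega>)" integrable, so the
   Bochner integrals in the profit condition never take their default value 0. *)
definition quasi_equilibrium ::
    "'a measure \<Rightarrow> ('a \<Rightarrow> real) \<Rightarrow> ('a \<Rightarrow> real) \<Rightarrow> (real \<Rightarrow> real) \<Rightarrow> (real \<Rightarrow> real) \<Rightarrow> bool" where
  "quasi_equilibrium M V U \<phi> P \<longleftrightarrow>
     \<phi> \<in> borel_measurable borel \<and> P \<in> borel_measurable borel \<and>
     ae_profit_maximising M U \<phi> P \<and> market_efficient M V U \<phi> P"

end

theory Submission
  imports Defs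
begin

text \<open>
  After an affine change of variables both \<open>V\<close> and \<open>U\<close> are standard normal; write \<open>a\<close> for the value,
  \<open>b\<close> for the noise, \<open>f\<close> for the strategy, \<open>p\<close> for the price and \<open>Y = f a + b\<close> for the order flow.
  The claim becomes \<open>f a = a\<close> and \<open>p y = y / 2\<close>.

  Averaging the price over the noise gives a smooth function \<open>g x = E p (x + b)\<close>, even if \<open>p\<close> is only
  measurable. Put \<open>G a = g (f a)\<close> and \<open>S a = g' (f a)\<close>. Profit maximisation says that the value
  function \<open>W a = sup_x (a - g x) x\<close> is a supremum of affine functions, hence convex, with derivative
  \<open>f\<close>; the first-order condition \<open>a = G + f S\<close> turns it into \<open>W = f\<^sup>2 S\<close>. Let \<open>u = sqrt (2 S)\<close> and let
  \<open>z = f u\<close>, which is the square root of \<open>2 W\<close> with the sign of \<open>f\<close>. From \<open>z\<^sup>2 = 2 W\<close> and \<open>W' = f\<close>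
  it follows that \<open>z\<close> is increasing, with \<open>z' = f / z = 1 / u\<close>. In the linear equilibrium \<open>z a = a\<close>
  and \<open>u = 1\<close>.

  Only three integral relations are extracted from the equilibrium.

  \<^item> Testing market efficiency against \<open>Y\<close> gives \<open>E W = E S\<close> (\<open>value_integral\<close>). As \<open>f\<close> need not be
    integrable, \<open>Y\<close> is truncated first; positivity of \<open>S\<close> makes the limit monotone.

  \<^item> Testing market efficiency against \<open>p Y\<close> gives \<open>E (a G) = E (p Y)\<^sup>2\<close>, and Bessel's inequality for the
    orthonormal functions \<open>1, b\<close> gives \<open>E (p Y)\<^sup>2 \<ge> E (G\<^sup>2 + S\<^sup>2)\<close> (\<open>energy_inequality\<close>).

  \<^item> Gaussian integration by parts, which for an increasing function with possible jumps is an
    inequality, gives \<open>E (1 / u) \<le> E (a z)\<close> (\<open>stein_inequality\<close>).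

  Together with \<open>E a\<^sup>2 = 1\<close> they say that the integral of
  \<open>(a\<^sup>2 - 1) + 2 (G\<^sup>2 + S\<^sup>2 - a G) + (W - S) + (1 / u - a z)\<close> is at most \<open>0\<close>. But this integrand is
  identically
  \<open>(z u - a)\<^sup>2 / 2 + (z - a)\<^sup>2 / 2 + (u - 1)\<^sup>2 (u\<^sup>3 + 2 u\<^sup>2 + 2 u + 2) / (2 u)\<close>,
  which is nonnegative. Hence \<open>z = a\<close> and \<open>u = 1\<close> almost everywhere, that is \<open>f a = z / u = a\<close>
  (\<open>strategy_eq\<close>). The price is then the projection of \<open>a\<close> on functions of \<open>a + b\<close>, which
  is \<open>(a + b) / 2\<close> because \<open>a\<close> and \<open>b\<close> are exchangeable (\<open>pricing_eq\<close>).
\<close>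

section \<open>Square-integrable functions\<close>

definition square_integrable :: "'a measure \<Rightarrow> ('a \<Rightarrow> real) \<Rightarrow> bool" where
  "square_integrable M f \<longleftrightarrow> f \<in> borel_measurable M \<and> integrable M (\<lambda>x. (f x)\<^sup>2)"

lemma square_integrable_mult:
  assumes "square_integrable M f" "square_integrable M g"
  shows "integrable M (\<lambda>x. f x * g x)"
proof (rule Bochner_Integration.integrable_bound)
  show "integrable M (\<lambda>x. (f x)\<^sup>2 + (g x)\<^sup>2)"
    using assms by (auto simp: square_integrable_def)
  show "(\<lambda>x. f x * g x) \<in> borel_measurable M"
    using assms by (auto simp: square_integrable_def)
  have "\<bar>s * t\<bar> \<le> s\<^sup>2 + t\<^sup>2" for s t :: real
  proof -
    have "0 \<le> (\<bar>s\<bar> - \<bar>t\<bar>)\<^sup>2" "0 \<le> \<bar>s\<bar> * \<bar>t\<bar>" by auto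
    then show ?thesis unfolding power2_diff power2_abs abs_mult mult.assoc by linarith
  qed
  then show "AE x in M. norm (f x * g x) \<le> norm ((f x)\<^sup>2 + (g x)\<^sup>2)"
    by auto
qed

lemma square_integrable_add:
  assumes "square_integrable M f" "square_integrable M g"
  shows "square_integrable M (\<lambda>x. f x + g x)"
proof -
  have "integrable M (\<lambda>x. (f x)\<^sup>2 + (g x)\<^sup>2 + 2 * (f x * g x))"
    using assms square_integrable_mult[OF assms]
    by (intro Bochner_Integration.integrable_add integrable_mult_right) (auto simp: square_integrable_def)
  then have "integrable M (\<lambda>x. (f x + g x)\<^sup>2)"
    by (simp add: power2_sum mult.assoc)
  then show ?thesis
    using assms by (auto simp: square_integrable_def)
qed

lemma square_integrable_cmult:
  "square_integrable M f \<Longrightarrow> square_integrable M (\<lambda>x. c * f x)"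
  by (auto simp: square_integrable_def power_mult_distrib)

lemma square_integrable_diff:
  assumes "square_integrable M f" "square_integrable M g"
  shows "square_integrable M (\<lambda>x. f x - g x)"
  using square_integrable_add[OF assms(1) square_integrable_cmult[OF assms(2), of "-1"]] by simp

lemma square_integrable_bound:
  assumes "square_integrable M g" "f \<in> borel_measurable M" "AE x in M. \<bar>f x\<bar> \<le> \<bar>g x\<bar>"
  shows "square_integrable M f"
proof -
  have "AE x in M. norm ((f x)\<^sup>2) \<le> norm ((g x)\<^sup>2)"
    using assms(3) by eventually_elim (simp add: abs_le_square_iff)
  then show ?thesis
    using assms Bochner_Integration.integrable_bound[of M "\<lambda>x. (g x)\<^sup>2" "\<lambda>x. (f x)\<^sup>2"]
    by (auto simp: square_integrable_def)
qed

lemma square_integrable_abs: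
  "square_integrable M f \<Longrightarrow> square_integrable M (\<lambda>x. \<bar>f x\<bar>)"
  by (auto simp: square_integrable_def)

lemma (in finite_measure) square_integrable_const: "square_integrable M (\<lambda>x. c)"
  by (auto simp: square_integrable_def)

lemma (in finite_measure) integrable_if_square_integrable:
  "square_integrable M f \<Longrightarrow> integrable M f"
  using square_integrable_mult[OF _ square_integrable_const[of 1]] by simp

section \<open>The standard normal law\<close>

definition gauss :: "real measure" where
  "gauss = density lborel (\<lambda>x. ennreal (std_normal_density x))"

lemma sets_gauss [measurable_cong, simp]: "sets gauss = sets borel"
  by (simp add: gauss_def)

lemma space_gauss [simp]: "space gauss = UNIV"
  by (simp add: gauss_def)

lemma measurable_gauss [simp]: "measurable gauss N = measurable borel N"
  by (rule measurable_cong_sets) simp_all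

interpretation gauss: prob_space gauss
  unfolding gauss_def by (rule prob_space_normal_density) simp

interpretation gauss2: pair_prob_space gauss gauss ..

lemma AE_gauss_iff: "(AE x in gauss. Q x) \<longleftrightarrow> (AE x in lborel. Q x)"
  unfolding gauss_def by (subst AE_density) (auto simp: normal_density_pos)

lemma integrable_gauss_iff:
  fixes F :: "real \<Rightarrow> real"
  assumes [measurable]: "F \<in> borel_measurable borel"
  shows "integrable gauss F \<longleftrightarrow> integrable lborel (\<lambda>x. std_normal_density x * F x)"
  unfolding gauss_def by (subst integrable_density) auto

lemma integral_gauss:
  fixes F :: "real \<Rightarrow> real"
  assumes [measurable]: "F \<in> borel_measurable borel"
  shows "(\<integral>x. F x \<partial>gauss) = (\<integral>x. std_normal_density x * F x \<partial>lborel)"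
  unfolding gauss_def by (subst integral_density) auto

lemma gauss_square_integrable_id: "square_integrable gauss (\<lambda>x. x)"
  using integrable_std_normal_moment[of 2]
  by (simp add: square_integrable_def integrable_gauss_iff)

lemma gauss_mean: "(\<integral>x. x \<partial>gauss) = 0"
  using integral_std_normal_moment_odd[of 0] by (simp add: integral_gauss)

lemma gauss_variance: "(\<integral>x. x\<^sup>2 \<partial>gauss) = 1"
  using integral_std_normal_moment_even[of 1] by (simp add: integral_gauss)

text \<open>
  The law \<open>N(h, 1)\<close> has density \<open>exp (h x - h\<^sup>2 / 2)\<close> with respect to \<open>N(0, 1)\<close>, so translating the
  argument of a function can be traded for a weight that is smooth in \<open>h\<close>.
\<close>
lemma gauss_shift:
  fixes F :: "real \<Rightarrow> real"
  assumes [measurable]: "F \<in> borel_measurable borel"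
  shows "integrable gauss (\<lambda>x. F (x + h)) \<longleftrightarrow> integrable gauss (\<lambda>x. F x * exp (h * x - h\<^sup>2 / 2))"
    and "(\<integral>x. F (x + h) \<partial>gauss) = (\<integral>x. F x * exp (h * x - h\<^sup>2 / 2) \<partial>gauss)"
proof -
  have *: "std_normal_density (- h + 1 * x) * F (- h + 1 * x + h) =
      std_normal_density x * (F x * exp (h * x - h\<^sup>2 / 2))" for x
  proof -
    have "std_normal_density (- h + x) = std_normal_density x * exp (h * x - h\<^sup>2 / 2)"
      by (simp add: std_normal_density_def flip: exp_add)
         (simp add: power2_eq_square field_simps)
    then show ?thesis by simp
  qed
  show "integrable gauss (\<lambda>x. F (x + h)) \<longleftrightarrow> integrable gauss (\<lambda>x. F x * exp (h * x - h\<^sup>2 / 2))"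
    using lborel_integrable_real_affine_iff[of 1 "\<lambda>x. std_normal_density x * F (x + h)" "-h"]
    by (simp only: *) (simp add: integrable_gauss_iff)
  show "(\<integral>x. F (x + h) \<partial>gauss) = (\<integral>x. F x * exp (h * x - h\<^sup>2 / 2) \<partial>gauss)"
    using lborel_integral_real_affine[of 1 "\<lambda>x. std_normal_density x * F (x + h)" "-h"]
    by (simp only: *) (simp add: integral_gauss)
qed

lemma gauss_integrable_exp: "integrable gauss (\<lambda>x. exp (c * x))"
proof -
  have "integrable gauss (\<lambda>x. exp (c * x - c\<^sup>2 / 2))"
    using gauss_shift(1)[of "\<lambda>_. 1" c] by simp
  then have "integrable gauss (\<lambda>x. exp (c\<^sup>2 / 2) * exp (c * x - c\<^sup>2 / 2))"
    by (rule integrable_mult_right)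
  then show ?thesis by (simp flip: exp_add)
qed

lemma gauss_square_integrable_exp: "square_integrable gauss (\<lambda>x. exp (c * x))"
  using gauss_integrable_exp[of "2 * c"]
  by (simp add: square_integrable_def exp_double mult.assoc)

text \<open>
  A second-order Taylor bound for the weight of \<open>gauss_shift\<close>, uniform in \<open>h\<close> and with a
  square-integrable majorant in \<open>x\<close>.
\<close>
lemma exp_shift_remainder_bound:
  fixes h x :: real
  assumes "\<bar>h\<bar> \<le> 1"
  shows "\<bar>exp (h * x - h\<^sup>2 / 2) - 1 - h * x\<bar> \<le> h\<^sup>2 * (1 + 3 * (exp (2 * x) + exp (- 2 * x)))"
proof -
  define w where "w = h * x - h\<^sup>2 / 2"
  define y where "y = \<bar>x\<bar> + 1 / 2"
  have "y \<ge> 0" by (simp add: y_def)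
  have wh: "\<bar>w\<bar> \<le> \<bar>h\<bar> * y"
  proof -
    have "\<bar>w\<bar> \<le> \<bar>h * x\<bar> + \<bar>h\<^sup>2 / 2\<bar>" unfolding w_def by (rule abs_triangle_ineq4)
    also have "\<dots> = \<bar>h\<bar> * \<bar>x\<bar> + \<bar>h\<bar> * \<bar>h\<bar> / 2" by (simp add: abs_mult power2_eq_square)
    also have "\<dots> \<le> \<bar>h\<bar> * \<bar>x\<bar> + \<bar>h\<bar> * 1 / 2"
      using assms by (intro add_left_mono divide_right_mono mult_left_mono) auto
    finally show ?thesis by (simp add: y_def algebra_simps)
  qed
  then have wy: "\<bar>w\<bar> \<le> y"
    using assms \<open>y \<ge> 0\<close> mult_right_mono[of "\<bar>h\<bar>" 1 y] by linarith
  obtain t where t: "\<bar>t\<bar> \<le> \<bar>w\<bar>" "exp w = (\<Sum>m<2. w ^ m / fact m) + exp t / fact 2 * w ^ 2"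
    using Maclaurin_exp_le[of w 2] by auto
  have e: "exp w - 1 - w = exp t / 2 * w\<^sup>2"
    using t(2) by (simp add: numeral_2_eq_2)
  have "w\<^sup>2 \<le> h\<^sup>2 * y\<^sup>2"
    using wh by (metis abs_ge_zero power2_abs power_mono power_mult_distrib)
  moreover have "exp t \<le> exp y" using t(1) wy by auto
  moreover have "y\<^sup>2 / 2 \<le> exp y"
    using exp_lower_Taylor_quadratic[OF \<open>y \<ge> 0\<close>] \<open>y \<ge> 0\<close> by linarith
  ultimately have "exp t / 2 * w\<^sup>2 \<le> exp y / 2 * (h\<^sup>2 * y\<^sup>2)"
    by (intro mult_mono) auto
  also have "\<dots> = h\<^sup>2 * (exp y * (y\<^sup>2 / 2))" by simp
  also have "\<dots> \<le> h\<^sup>2 * (exp y * exp y)"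
    using \<open>y\<^sup>2 / 2 \<le> exp y\<close> by (intro mult_left_mono) auto
  also have "exp y * exp y = exp 1 * exp (2 * \<bar>x\<bar>)"
    by (simp add: y_def flip: exp_add)
  also have "h\<^sup>2 * (exp 1 * exp (2 * \<bar>x\<bar>)) \<le> h\<^sup>2 * (3 * (exp (2 * x) + exp (- 2 * x)))"
    using exp_le by (intro mult_left_mono mult_mono) (auto simp: abs_if)
  finally have "\<bar>exp w - 1 - w\<bar> \<le> h\<^sup>2 * (3 * (exp (2 * x) + exp (- 2 * x)))"
    unfolding e by simp
  moreover have "\<bar>exp w - 1 - h * x\<bar> \<le> \<bar>exp w - 1 - w\<bar> + h\<^sup>2 / 2"
    unfolding w_def using zero_le_power2[of h] by linarith
  moreover have "0 \<le> h\<^sup>2" by simp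
  ultimately have "\<bar>exp w - 1 - h * x\<bar> \<le> h\<^sup>2 + h\<^sup>2 * (3 * (exp (2 * x) + exp (- 2 * x)))"
    by linarith
  then show ?thesis unfolding w_def by (simp add: distrib_left)
qed

text \<open>
  After the change of weight only the weight depends on \<open>h\<close>, and its derivative at \<open>h = 0\<close> is \<open>x\<close>; so
  averaging makes a merely measurable \<open>F\<close> differentiable. The lemma serves twice: with \<open>F\<close> a price, for
  the first-order condition of the insider, and with \<open>F\<close> a monotone function, as Gaussian integration
  by parts.
\<close>
lemma gauss_shift_derivative:
  assumes F: "square_integrable gauss F"
  shows "integrable gauss (\<lambda>x. F (x + h))"
    and "((\<lambda>h. \<integral>x. F (x + h) \<partial>gauss) has_real_derivative (\<integral>x. x * F x \<partial>gauss)) (at 0)"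
proof -
  have [measurable]: "F \<in> borel_measurable borel"
    using F by (simp add: square_integrable_def)
  have exp_split: "exp (h * x - h\<^sup>2 / 2) = exp (- h\<^sup>2 / 2) * exp (h * x)" for h x :: real
    unfolding exp_add[symmetric] by (rule arg_cong[where f=exp]) (simp add: field_simps)
  have ie: "integrable gauss (\<lambda>x. F x * exp (h * x - h\<^sup>2 / 2))" for h
    using square_integrable_mult[OF F square_integrable_cmult[OF gauss_square_integrable_exp[of h], of "exp (- h\<^sup>2 / 2)"]]
    by (simp only: exp_split)
  then show "integrable gauss (\<lambda>x. F (x + h))"
    by (simp add: gauss_shift)
  define K where "K = (\<lambda>x::real. 1 + 3 * (exp (2 * x) + exp (- 2 * x)))"
  have K: "square_integrable gauss K"
    unfolding K_def
    by (intro square_integrable_add square_integrable_cmult gauss_square_integrable_exp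
        gauss.square_integrable_const)
  have [measurable]: "K \<in> borel_measurable borel" by (simp add: K_def)
  define G where "G = (\<lambda>h. \<integral>x. F (x + h) \<partial>gauss)"
  define m where "m = (\<integral>x. x * F x \<partial>gauss)"
  define C where "C = (\<integral>x. \<bar>F x\<bar> * K x \<partial>gauss)"
  have iF: "integrable gauss F" by (rule gauss.integrable_if_square_integrable[OF F])
  have ixF: "integrable gauss (\<lambda>x. x * F x)"
    by (rule square_integrable_mult[OF gauss_square_integrable_id F])
  have iK: "integrable gauss (\<lambda>x. \<bar>F x\<bar> * K x)"
    by (rule square_integrable_mult[OF square_integrable_abs[OF F] K])
  have bound: "\<bar>G h - G 0 - h * m\<bar> \<le> h\<^sup>2 * C" if "\<bar>h\<bar> \<le> 1" for h
  proof -
    have eq: "G h - G 0 - h * m =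
        (\<integral>x. F x * exp (h * x - h\<^sup>2 / 2) - F x - h * (x * F x) \<partial>gauss)"
      unfolding G_def m_def gauss_shift(2)[OF \<open>F \<in> borel_measurable borel\<close>]
      using ie[of h] iF ixF by simp
    have "\<bar>G h - G 0 - h * m\<bar> \<le> (\<integral>x. \<bar>F x * exp (h * x - h\<^sup>2 / 2) - F x - h * (x * F x)\<bar> \<partial>gauss)"
      unfolding eq by (rule integral_abs_bound)
    also have "\<dots> \<le> (\<integral>x. h\<^sup>2 * (\<bar>F x\<bar> * K x) \<partial>gauss)"
    proof (rule integral_mono)
      fix x
      have "F x * exp (h * x - h\<^sup>2 / 2) - F x - h * (x * F x)
          = F x * (exp (h * x - h\<^sup>2 / 2) - 1 - h * x)"
        by algebra
      then have "\<bar>F x * exp (h * x - h\<^sup>2 / 2) - F x - h * (x * F x)\<bar>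
          = \<bar>F x\<bar> * \<bar>exp (h * x - h\<^sup>2 / 2) - 1 - h * x\<bar>"
        by (simp only: abs_mult)
      also have "\<dots> \<le> \<bar>F x\<bar> * (h\<^sup>2 * K x)"
        using exp_shift_remainder_bound[OF that, of x] unfolding K_def
        by (intro mult_left_mono) simp_all
      finally show "\<bar>F x * exp (h * x - h\<^sup>2 / 2) - F x - h * (x * F x)\<bar> \<le> h\<^sup>2 * (\<bar>F x\<bar> * K x)"
        by (simp only: mult.left_commute)
    next
      show "integrable gauss (\<lambda>x. \<bar>F x * exp (h * x - h\<^sup>2 / 2) - F x - h * (x * F x)\<bar>)"
        by (intro integrable_abs Bochner_Integration.integrable_diff integrable_mult_right ie iF ixF)
      show "integrable gauss (\<lambda>x. h\<^sup>2 * (\<bar>F x\<bar> * K x))"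
        by (intro integrable_mult_right iK)
    qed
    also have "\<dots> = h\<^sup>2 * C" unfolding C_def by simp
    finally show ?thesis .
  qed
  have "((\<lambda>h. (G h - G 0) / h - m) \<longlongrightarrow> 0) (at 0)"
  proof (rule Lim_null_comparison)
    show "((\<lambda>h. \<bar>h\<bar> * C) \<longlongrightarrow> 0) (at 0)"
      by (rule tendsto_eq_intros refl | simp)+
    have "\<forall>\<^sub>F h in at 0. \<bar>h\<bar> \<le> 1 \<and> h \<noteq> (0::real)"
      by (auto simp: eventually_at intro!: exI[of _ 1])
    then show "\<forall>\<^sub>F h in at 0. norm ((G h - G 0) / h - m) \<le> \<bar>h\<bar> * C"
    proof eventually_elim
      case (elim h)
      then have "(G h - G 0) / h - m = (G h - G 0 - h * m) / h" by (simp add: field_simps)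
      then have "\<bar>(G h - G 0) / h - m\<bar> \<le> h\<^sup>2 * C / \<bar>h\<bar>"
        using bound[of h] elim by (simp add: divide_right_mono)
      also have "h\<^sup>2 * C / \<bar>h\<bar> = \<bar>h\<bar> * C"
        using elim by (simp add: power2_eq_square abs_if)
      finally show ?case by simp
    qed
  qed
  then have "((\<lambda>h. (G h - G 0) / h) \<longlongrightarrow> m) (at 0)"
    by (rule LIM_zero_cancel)
  then show "((\<lambda>h. \<integral>x. F (x + h) \<partial>gauss) has_real_derivative (\<integral>x. x * F x \<partial>gauss)) (at 0)"
    unfolding DERIV_def G_def m_def by simp
qed

lemma gauss_shift_quotients:
  assumes F: "square_integrable gauss F" and s: "s \<noteq> 0"
  shows "(\<lambda>n. \<integral>x. (F (x + s / real (Suc n)) - F x) / (s / real (Suc n)) \<partial>gauss)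
    \<longlonglongrightarrow> (\<integral>x. x * F x \<partial>gauss)"
proof -
  have "((\<lambda>h. ((\<integral>x. F (x + h) \<partial>gauss) - (\<integral>x. F x \<partial>gauss)) / h) \<longlongrightarrow> (\<integral>x. x * F x \<partial>gauss)) (at 0)"
    using gauss_shift_derivative(2)[OF F] unfolding DERIV_def by simp
  moreover have "filterlim (\<lambda>n. s / real (Suc n)) (at 0) sequentially"
    using tendsto_mult_right_zero[OF LIMSEQ_Suc[OF lim_1_over_n], of s] s
    by (simp add: filterlim_at del: of_nat_Suc)
  ultimately have "(\<lambda>n. ((\<integral>x. F (x + s / real (Suc n)) \<partial>gauss) - (\<integral>x. F x \<partial>gauss)) / (s / real (Suc n)))
      \<longlonglongrightarrow> (\<integral>x. x * F x \<partial>gauss)"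
    by (rule filterlim_compose)
  then show ?thesis
    using gauss_shift_derivative(1)[OF F] gauss.integrable_if_square_integrable[OF F]
    by (simp del: of_nat_Suc)
qed

text \<open>
  Bessel's inequality: \<open>1\<close> and \<open>x\<close> are orthonormal, and the squared distance of \<open>h\<close> from its projection
  on their span is nonnegative.
\<close>
lemma gauss_bessel:
  assumes h: "square_integrable gauss h"
  shows "(\<integral>x. h x \<partial>gauss)\<^sup>2 + (\<integral>x. x * h x \<partial>gauss)\<^sup>2 \<le> (\<integral>x. (h x)\<^sup>2 \<partial>gauss)"
proof -
  define m n where "m = (\<integral>x. h x \<partial>gauss)" and "n = (\<integral>x. x * h x \<partial>gauss)"
  note ints = h[unfolded square_integrable_def, THEN conjunct2]
    gauss.integrable_if_square_integrable[OF h]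
    square_integrable_mult[OF gauss_square_integrable_id h]
    gauss.integrable_if_square_integrable[OF gauss_square_integrable_id]
    gauss_square_integrable_id[unfolded square_integrable_def, THEN conjunct2]
  have "0 \<le> (\<integral>x. (h x - m - n * x)\<^sup>2 \<partial>gauss)"
    by (rule integral_nonneg_AE) simp
  also have "(\<lambda>x. (h x - m - n * x)\<^sup>2) =
      (\<lambda>x. (h x)\<^sup>2 - 2 * m * h x - 2 * n * (x * h x) + 2 * m * n * x + n\<^sup>2 * x\<^sup>2 + m\<^sup>2)"
    by (auto simp: power2_eq_square algebra_simps)
  also have "(\<integral>x. (h x)\<^sup>2 - 2 * m * h x - 2 * n * (x * h x) + 2 * m * n * x + n\<^sup>2 * x\<^sup>2 + m\<^sup>2 \<partial>gauss)
      = (\<integral>x. (h x)\<^sup>2 \<partial>gauss) - 2 * m * m - 2 * n * n + 2 * m * n * 0 + n\<^sup>2 * 1 + m\<^sup>2"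
    using ints by (simp add: gauss_mean gauss_variance m_def[symmetric] n_def[symmetric] gauss.prob_space[simplified])
  finally show ?thesis unfolding m_def[symmetric] n_def[symmetric] by (simp add: power2_eq_square)
qed

text \<open>
  The set where \<open>Q\<close> fails is enlarged to a Borel null set first: profit maximisation quantifies over
  all real orders, so it is not evidently a measurable property of the value.
\<close>
lemma AE_lborel_affine:
  fixes t c :: real
  assumes "AE x in lborel. Q x" "c \<noteq> 0"
  shows "AE x in lborel. Q (t + c * x)"
proof -
  obtain N where N: "{x. \<not> Q x} \<subseteq> N" "N \<in> null_sets lborel"
    using assms(1) unfolding eventually_ae_filter by auto
  then have [measurable]: "N \<in> sets borel" by auto
  have "AE x in lborel. x \<notin> N" using N(2) by (rule AE_not_in)
  then have "AE x in lborel. t + c * x \<notin> N"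
    by (intro AE_borel_affine assms(2)) measurable
  then show ?thesis by eventually_elim (use N(1) in auto)
qed

lemma AE_gauss_shift: "AE x in gauss. Q x \<Longrightarrow> AE x in gauss. Q (x + h)"
  using AE_lborel_affine[of Q 1 h] by (simp add: AE_gauss_iff add.commute)

lemma AE_gauss_neq: "AE x in gauss. x \<noteq> c"
  unfolding AE_gauss_iff by (rule AE_lborel_singleton)

section \<open>Pairs of independent standard normal variables\<close>

lemma AE_gauss_pair_fst:
  assumes "AE x in gauss. Q x" shows "AE w in gauss \<Otimes>\<^sub>M gauss. Q (fst w)"
proof -
  have "AE x in distr (gauss \<Otimes>\<^sub>M gauss) gauss fst. Q x"
    using assms by (simp only: gauss.distr_pair_fst)
  then show ?thesis by (rule AE_distrD[OF measurable_fst])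
qed

lemma square_integrable_fst:
  assumes "square_integrable gauss h"
  shows "square_integrable (gauss \<Otimes>\<^sub>M gauss) (\<lambda>(x, y). h x)"
proof -
  have [measurable]: "h \<in> borel_measurable borel"
    using assms by (simp add: square_integrable_def)
  have "integrable (distr (gauss \<Otimes>\<^sub>M gauss) gauss fst) (\<lambda>x. (h x)\<^sup>2)"
    using assms gauss.distr_pair_fst[of gauss] by (simp add: square_integrable_def)
  then have "integrable (gauss \<Otimes>\<^sub>M gauss) (\<lambda>w. (h (fst w))\<^sup>2)"
    by (subst (asm) integrable_distr_eq) simp_all
  then show ?thesis by (simp add: square_integrable_def case_prod_unfold)
qed

lemma square_integrable_snd:
  assumes "square_integrable gauss h"
  shows "square_integrable (gauss \<Otimes>\<^sub>M gauss) (\<lambda>(x, y). h y)"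
proof -
  have [measurable]: "h \<in> borel_measurable borel"
    using assms by (simp add: square_integrable_def)
  have "integrable (gauss \<Otimes>\<^sub>M gauss) (\<lambda>(x, y). (h x)\<^sup>2)"
    using square_integrable_fst[OF assms] by (simp add: square_integrable_def case_prod_unfold)
  from gauss2.integrable_product_swap[OF this] show ?thesis
    by (simp add: square_integrable_def case_prod_unfold)
qed

lemma gauss_pair_coordinates_square_integrable:
  "square_integrable (gauss \<Otimes>\<^sub>M gauss) fst" "square_integrable (gauss \<Otimes>\<^sub>M gauss) snd"
  using square_integrable_fst[OF gauss_square_integrable_id]
    square_integrable_snd[OF gauss_square_integrable_id] by (simp_all add: case_prod_unfold)

lemma gauss_pair_moments:
  shows "(\<integral>w. fst w \<partial>(gauss \<Otimes>\<^sub>M gauss)) = 0" "(\<integral>w. snd w \<partial>(gauss \<Otimes>\<^sub>M gauss)) = 0"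
    and "(\<integral>w. (fst w)\<^sup>2 \<partial>(gauss \<Otimes>\<^sub>M gauss)) = 1" "(\<integral>w. (snd w)\<^sup>2 \<partial>(gauss \<Otimes>\<^sub>M gauss)) = 1"
    and "(\<integral>w. fst w * snd w \<partial>(gauss \<Otimes>\<^sub>M gauss)) = 0"
proof -
  let ?P = "gauss \<Otimes>\<^sub>M gauss"
  note a2 = gauss_pair_coordinates_square_integrable(1) and b2 = gauss_pair_coordinates_square_integrable(2)
  note ints = gauss2.integrable_if_square_integrable[OF a2] gauss2.integrable_if_square_integrable[OF b2]
    a2[unfolded square_integrable_def, THEN conjunct2] b2[unfolded square_integrable_def, THEN conjunct2]
    square_integrable_mult[OF a2 b2]
  note fub = ints[THEN gauss2.integral_fst', symmetric]
  show "(\<integral>w. fst w \<partial>?P) = 0" "(\<integral>w. snd w \<partial>?P) = 0"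
    "(\<integral>w. (fst w)\<^sup>2 \<partial>?P) = 1" "(\<integral>w. (snd w)\<^sup>2 \<partial>?P) = 1" "(\<integral>w. fst w * snd w \<partial>?P) = 0"
    by (simp_all add: fub gauss_mean gauss_variance gauss.prob_space[simplified])
qed

section \<open>Truncation\<close>

text \<open>
  Truncations of the identity, which stand in for the order flow as a test function until it is known to be
  square integrable.
\<close>
definition clamp :: "nat \<Rightarrow> real \<Rightarrow> real" where
  "clamp k y = max (- real k) (min (real k) y)"

lemma clamp_measurable [measurable]: "clamp k \<in> borel_measurable borel"
  unfolding clamp_def by measurable

lemma clamp_lipschitz: "\<bar>clamp k (x + y) - clamp k x\<bar> \<le> \<bar>y\<bar>"
  by (auto simp: clamp_def max_def min_def)

lemma clamp_bounded: "\<bar>clamp k x\<bar> \<le> real k"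
  by (auto simp: clamp_def max_def min_def)

lemma clamp_tendsto: "(\<lambda>k. clamp k x) \<longlonglongrightarrow> x"
proof (rule tendsto_eventually)
  obtain N :: nat where "\<bar>x\<bar> \<le> real N" using real_arch_simple by blast
  then show "\<forall>\<^sub>F k in sequentially. clamp k x = x"
    by (intro eventually_sequentiallyI[of N]) (auto simp: clamp_def max_def min_def abs_le_iff)
qed

lemma clamp_mult_mono: "j \<le> k \<Longrightarrow> x * clamp j x \<le> x * clamp k x"
proof -
  assume "j \<le> k"
  then have "0 \<le> x \<Longrightarrow> clamp j x \<le> clamp k x" "x \<le> 0 \<Longrightarrow> clamp k x \<le> clamp j x"
    by (auto simp: clamp_def max_def min_def)
  then show ?thesis
    by (cases "0 \<le> x") (auto intro: mult_left_mono mult_left_mono_neg)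
qed

section \<open>The normalised model\<close>

text \<open>
  Values and noise are the coordinates of a pair of independent standard normal variables.
  The conditional expectation is encoded by its orthogonality relations against square-integrable
  functions of the order flow; square integrability of the price is Jensen's inequality.
\<close>
locale standard_kyle =
  fixes f p :: "real \<Rightarrow> real"
  assumes f_measurable [measurable]: "f \<in> borel_measurable borel"
    and p_measurable [measurable]: "p \<in> borel_measurable borel"
    and price_L2: "square_integrable (gauss \<Otimes>\<^sub>M gauss) (\<lambda>(a, b). p (f a + b))"
    and efficient: "\<And>\<psi>. \<psi> \<in> borel_measurable borel \<Longrightarrow>
      square_integrable (gauss \<Otimes>\<^sub>M gauss) (\<lambda>(a, b). \<psi> (f a + b)) \<Longrightarrow>
      (\<integral>(a, b). a * \<psi> (f a + b) \<partial>(gauss \<Otimes>\<^sub>M gauss)) =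
      (\<integral>(a, b). p (f a + b) * \<psi> (f a + b) \<partial>(gauss \<Otimes>\<^sub>M gauss))"
    and optimal: "AE a in gauss. \<forall>x. (\<integral>b. (a - p (x + b)) * x \<partial>gauss)
      \<le> (\<integral>b. (a - p (f a + b)) * f a \<partial>gauss)"
begin

text \<open>The insider faces \<open>g\<close>, the price averaged over the noise.\<close>
definition g :: "real \<Rightarrow> real" where "g x = (\<integral>b. p (x + b) \<partial>gauss)"

definition G :: "real \<Rightarrow> real" where "G a = g (f a)"

text \<open>By Gaussian integration by parts this is the derivative of \<open>g\<close> at \<open>f a\<close>.\<close>
definition S :: "real \<Rightarrow> real" where "S a = (\<integral>b. b * p (f a + b) \<partial>gauss)"

text \<open>The value function of the insider, see \<open>W_eq_profit\<close>.\<close>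
definition W :: "real \<Rightarrow> real" where "W a = (f a)\<^sup>2 * S a"

definition regular :: "real \<Rightarrow> bool" where
  "regular a \<longleftrightarrow> square_integrable gauss (\<lambda>b. p (f a + b)) \<and> (\<forall>x. (a - g x) * x \<le> (a - G a) * f a)"

lemma G_measurable [measurable]: "G \<in> borel_measurable borel"
  unfolding G_def g_def by measurable

lemma S_measurable [measurable]: "S \<in> borel_measurable borel"
  unfolding S_def by measurable

lemma W_measurable [measurable]: "W \<in> borel_measurable borel"
  unfolding W_def by measurable

lemma price_sq_integrable: "integrable (gauss \<Otimes>\<^sub>M gauss) (\<lambda>(a, b). (p (f a + b))\<^sup>2)"
  using price_L2 by (simp add: square_integrable_def case_prod_unfold)

lemma AE_price_L2: "AE a in gauss. square_integrable gauss (\<lambda>b. p (f a + b))"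
proof -
  have "AE a in gauss. integrable gauss (\<lambda>b. (p (f a + b))\<^sup>2)"
    using gauss2.AE_integrable_fst'[OF price_sq_integrable] by simp
  then show ?thesis by (simp add: square_integrable_def)
qed

text \<open>
  One order at which the price is square integrable suffices: another order only changes the
  Gaussian weight.
\<close>
lemma integrable_price: "integrable gauss (\<lambda>b. p (x + b))"
proof -
  have "\<exists>a. square_integrable gauss (\<lambda>b. p (f a + b))"
    using AE_price_L2 gauss.AE_False by (metis (mono_tags, lifting) eventually_mono)
  then obtain a where "square_integrable gauss (\<lambda>b. p (f a + b))" ..
  from gauss_shift_derivative(1)[OF this, of "x - f a"] show ?thesis
    by (simp add: algebra_simps)
qed

lemma profit_eq: "(\<integral>b. (a - p (x + b)) * x \<partial>gauss) = (a - g x) * x"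
  using integrable_price[of x] by (simp add: g_def gauss.prob_space[simplified])

lemma AE_regular: "AE a in gauss. regular a"
  using optimal AE_price_L2 unfolding profit_eq regular_def G_def by eventually_elim simp

text \<open>
  Near \<open>f a\<close> the averaged price is differentiable by \<open>gauss_shift_derivative\<close>, with derivative
  \<open>S a\<close>, so the derivative of the profit vanishes at the maximiser.
\<close>
lemma first_order_condition:
  assumes "regular a" shows "a - G a = f a * S a"
proof -
  have "((\<lambda>h. \<integral>b. p (f a + (b + h)) \<partial>gauss) has_real_derivative S a) (at 0)"
    using gauss_shift_derivative(2)[of "\<lambda>b. p (f a + b)"] assms
    unfolding regular_def S_def by simp
  then have d: "((\<lambda>h. g (f a + h)) has_real_derivative S a) (at 0)"
    unfolding g_def by (simp add: add_ac)
  have "((\<lambda>h. (a - g (f a + h)) * (f a + h)) has_real_derivative (a - G a - f a * S a)) (at 0)"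
    by (rule derivative_eq_intros d refl | simp add: G_def)+
  then have "a - G a - f a * S a = 0"
    by (rule DERIV_local_max[of _ _ _ 1]) (use assms in \<open>auto simp: regular_def G_def\<close>)
  then show ?thesis by simp
qed

lemma W_eq_profit: "regular a \<Longrightarrow> W a = (a - G a) * f a"
  using first_order_condition[of a] by (simp add: W_def power2_eq_square)

lemma W_nonneg: "regular a \<Longrightarrow> 0 \<le> W a"
  unfolding W_eq_profit by (auto simp: regular_def dest!: spec[of _ 0])

text \<open>
  An insider with value \<open>a'\<close> can place the order \<open>f a\<close>. This says that \<open>f a\<close> is a subgradient of \<open>W\<close>
  at \<open>a\<close>.
\<close>
lemma W_subgradient:
  assumes "regular a" "regular a'"
  shows "W a + f a * (a' - a) \<le> W a'"
proof -
  have "W a + f a * (a' - a) = (a' - g (f a)) * f a"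
    unfolding W_eq_profit[OF assms(1)] G_def by (simp add: algebra_simps)
  also have "\<dots> \<le> W a'" using assms(2) unfolding W_eq_profit[OF assms(2)] regular_def by blast
  finally show ?thesis .
qed

lemma f_mono:
  assumes "regular a" "regular a'" "a < a'"
  shows "f a \<le> f a'"
proof -
  have "f a * (a' - a) \<le> f a' * (a' - a)"
    using W_subgradient[OF assms(1,2)] W_subgradient[OF assms(2,1)] by (simp add: algebra_simps)
  then show ?thesis using assms(3) by simp
qed

definition nondegenerate :: "real \<Rightarrow> bool" where
  "nondegenerate a \<longleftrightarrow> regular a \<and> f a \<noteq> 0 \<and> 0 < S a"

text \<open>
  If \<open>f a = 0\<close>, the first-order condition forces \<open>a = g 0\<close>. If \<open>W a = 0\<close> although \<open>f a \<noteq> 0\<close>, then the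
  convex function \<open>W \<ge> 0\<close> takes its minimum at \<open>a\<close> and has there a nonzero slope, which is possible at
  only one point for each sign of the slope.
\<close>
lemma AE_nondegenerate: "AE a in gauss. nondegenerate a"
proof -
  have sing: "AE a in gauss. \<not> Q a" if Q: "\<And>a a'. Q a \<Longrightarrow> Q a' \<Longrightarrow> a = a'" for Q
  proof (cases "\<exists>c. Q c")
    case True
    then obtain c where "Q c" ..
    then show ?thesis using AE_gauss_neq[of c] Q by (auto elim!: eventually_mono)
  qed simp
  have W0: "a = a'" if "regular a" "regular a'" "W a = 0" "W a' = 0" "0 < f a * f a'" for a a'
  proof -
    have "f a * (a' - a) \<le> 0" "f a' * (a - a') \<le> 0"
      using W_subgradient[OF that(1,2)] W_subgradient[OF that(2,1)] that by auto
    then show ?thesis using that(5) by (auto simp: mult_le_0_iff zero_less_mult_iff)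
  qed
  have 1: "AE a in gauss. \<not> (regular a \<and> W a = 0 \<and> 0 < f a)"
    by (rule sing) (auto intro!: W0)
  have 2: "AE a in gauss. \<not> (regular a \<and> W a = 0 \<and> f a < 0)"
    by (rule sing) (auto intro!: W0 simp: mult_neg_neg)
  show ?thesis
    using AE_regular AE_gauss_neq[of "g 0"] 1 2
  proof eventually_elim
    case (elim a)
    have "f a \<noteq> 0"
      using first_order_condition[of a] elim by (auto simp: G_def)
    moreover from this have "W a \<noteq> 0" "0 \<le> W a"
      using elim W_nonneg[of a] by auto
    ultimately show ?case
      using elim by (auto simp: nondegenerate_def W_def zero_le_mult_iff less_le)
  qed
qed

section \<open>Consequences of market efficiency\<close>

lemma G_S_bound:
  "AE a in gauss. (G a)\<^sup>2 + (S a)\<^sup>2 \<le> (\<integral>b. (p (f a + b))\<^sup>2 \<partial>gauss)"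
  using AE_price_L2
proof eventually_elim
  case (elim a)
  show ?case using gauss_bessel[OF elim] by (simp add: G_def g_def S_def)
qed

lemma G_L2: "square_integrable gauss G" and S_L2: "square_integrable gauss S"
proof -
  have i: "integrable gauss (\<lambda>a. \<integral>b. (p (f a + b))\<^sup>2 \<partial>gauss)"
    using gauss2.integrable_fst'[OF price_sq_integrable] by simp
  have "AE a in gauss. norm ((G a)\<^sup>2) \<le> norm (\<integral>b. (p (f a + b))\<^sup>2 \<partial>gauss)"
    using G_S_bound
  proof eventually_elim
    case (elim a) then show ?case using zero_le_power2[of "S a"] zero_le_power2[of "G a"]
      unfolding real_norm_def by linarith
  qed
  then show "square_integrable gauss G"
    unfolding square_integrable_def by (auto intro: Bochner_Integration.integrable_bound[OF i])
  have "AE a in gauss. norm ((S a)\<^sup>2) \<le> norm (\<integral>b. (p (f a + b))\<^sup>2 \<partial>gauss)"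
    using G_S_bound
  proof eventually_elim
    case (elim a) then show ?case using zero_le_power2[of "S a"] zero_le_power2[of "G a"]
      unfolding real_norm_def by linarith
  qed
  then show "square_integrable gauss S"
    unfolding square_integrable_def by (auto intro: Bochner_Integration.integrable_bound[OF i])
qed

text \<open>
  Market efficiency tested against the price itself gives \<open>E (a G) = E (p Y)\<^sup>2\<close>; Bessel's inequality
  is applied to the price for each fixed value \<open>a\<close>.
\<close>
lemma energy_inequality:
  "(\<integral>a. (G a)\<^sup>2 + (S a)\<^sup>2 \<partial>gauss) \<le> (\<integral>a. a * G a \<partial>gauss)"
proof -
  have i: "integrable (gauss \<Otimes>\<^sub>M gauss) (\<lambda>(a, b). a * p (f a + b))"
    using square_integrable_mult[OF square_integrable_fst[OF gauss_square_integrable_id] price_L2]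
    by (simp add: case_prod_unfold)
  have "(\<integral>a. (G a)\<^sup>2 + (S a)\<^sup>2 \<partial>gauss) \<le> (\<integral>a. (\<integral>b. (p (f a + b))\<^sup>2 \<partial>gauss) \<partial>gauss)"
    using G_S_bound G_L2 S_L2 gauss2.integrable_fst'[OF price_sq_integrable]
    by (intro integral_mono_AE) (auto simp: square_integrable_def)
  also have "\<dots> = (\<integral>(a, b). (p (f a + b))\<^sup>2 \<partial>(gauss \<Otimes>\<^sub>M gauss))"
    using gauss2.integral_fst'[OF price_sq_integrable] by simp
  also have "\<dots> = (\<integral>(a, b). a * p (f a + b) \<partial>(gauss \<Otimes>\<^sub>M gauss))"
    using efficient[OF p_measurable price_L2] by (simp add: power2_eq_square)
  also have "\<dots> = (\<integral>a. (\<integral>b. a * p (f a + b) \<partial>gauss) \<partial>gauss)"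
    using gauss2.integral_fst'[OF i] by simp
  also have "\<dots> = (\<integral>a. a * G a \<partial>gauss)"
    by (simp add: G_def g_def)
  finally show ?thesis .
qed

text \<open>
  Formally, \<open>0 = E ((a - p Y) Y) = E ((a - G) f) + E ((a - p Y) b) = E W - E S\<close>. With \<open>clamp k\<close> in place
  of the identity the first term becomes \<open>E ((a - G) clamp k (f a))\<close>, whose integrand \<open>S f clamp k f\<close>
  increases to \<open>W\<close>. The second becomes \<open>E ((a - p Y) (clamp k Y - clamp k (f a)))\<close>, which is dominated
  by \<open>\<bar>(a - p Y) b\<bar>\<close> because \<open>clamp k\<close> is 1-Lipschitz, and tends to \<open>E ((a - p Y) b) = - E S\<close>.
\<close>
lemma value_integral: "integrable gauss W" "(\<integral>a. W a \<partial>gauss) = (\<integral>a. S a \<partial>gauss)"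
proof -
  let ?P = "gauss \<Otimes>\<^sub>M gauss"
  have a2: "square_integrable ?P (\<lambda>(a, b). a)" and b2: "square_integrable ?P (\<lambda>(a, b). b)"
    using square_integrable_fst[OF gauss_square_integrable_id]
      square_integrable_snd[OF gauss_square_integrable_id] by auto
  have D2: "square_integrable ?P (\<lambda>(a, b). p (f a + b) - a)"
    using square_integrable_diff[OF price_L2 a2] by (simp add: case_prod_unfold)
  have c2: "square_integrable ?P (\<lambda>(a, b). clamp k (f a + b))"
    and c2': "square_integrable ?P (\<lambda>(a, b). clamp k (f a))" for k
    by (rule square_integrable_bound[OF gauss2.square_integrable_const[of "real k"]];
        simp add: case_prod_unfold clamp_bounded)+
  have i1: "integrable ?P (\<lambda>(a, b). (p (f a + b) - a) * clamp k (f a + b))"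
    and i2: "integrable ?P (\<lambda>(a, b). (p (f a + b) - a) * clamp k (f a))" for k
    using square_integrable_mult[OF D2 c2[of k]] square_integrable_mult[OF D2 c2'[of k]]
    by (simp_all add: case_prod_unfold)
  have i3: "integrable ?P (\<lambda>(a, b). (p (f a + b) - a) * b)"
    using square_integrable_mult[OF D2 b2] by (simp add: case_prod_unfold)
  have z: "(\<integral>(a, b). (p (f a + b) - a) * clamp k (f a + b) \<partial>?P) = 0" for k
  proof -
    have "integrable ?P (\<lambda>(a, b). p (f a + b) * clamp k (f a + b))"
      "integrable ?P (\<lambda>(a, b). a * clamp k (f a + b))"
      using square_integrable_mult[OF price_L2 c2[of k]] square_integrable_mult[OF a2 c2[of k]]
      by (simp_all add: case_prod_unfold)
    then show ?thesis
      using efficient[OF clamp_measurable c2[of k]]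
      by (simp add: case_prod_unfold left_diff_distrib)
  qed
  have lhs_int: "integrable gauss (\<lambda>a. (a - G a) * clamp k (f a))" for k
    using square_integrable_mult[OF square_integrable_diff[OF gauss_square_integrable_id G_L2]
      square_integrable_bound[OF gauss.square_integrable_const[of "real k"], of "\<lambda>a. clamp k (f a)"]]
    by (simp add: clamp_bounded)
  have lhs: "(\<integral>a. (a - G a) * clamp k (f a) \<partial>gauss) =
      (\<integral>(a, b). (p (f a + b) - a) * (clamp k (f a + b) - clamp k (f a)) \<partial>?P)" for k
  proof -
    have "(\<integral>(a, b). (p (f a + b) - a) * clamp k (f a) \<partial>?P) =
        (\<integral>a. (\<integral>b. (p (f a + b) - a) * clamp k (f a) \<partial>gauss) \<partial>gauss)"
      using gauss2.integral_fst'[OF i2[of k]] by simp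
    also have "\<dots> = (\<integral>a. - ((a - G a) * clamp k (f a)) \<partial>gauss)"
      using integrable_price
      by (simp add: G_def g_def gauss.prob_space[simplified] left_diff_distrib)
    also have "\<dots> = - (\<integral>a. (a - G a) * clamp k (f a) \<partial>gauss)"
      by (rule integral_minus)
    finally show ?thesis
      using z[of k] i1[of k] i2[of k] by (simp add: case_prod_unfold right_diff_distrib)
  qed
  have "(\<lambda>k. \<integral>w. (case w of (a, b) \<Rightarrow> (p (f a + b) - a) * (clamp k (f a + b) - clamp k (f a))) \<partial>?P)
      \<longlonglongrightarrow> (\<integral>(a, b). (p (f a + b) - a) * b \<partial>?P)"
  proof (rule integral_dominated_convergence[where w="\<lambda>(a, b). \<bar>(p (f a + b) - a) * b\<bar>"])
    show "integrable ?P (\<lambda>(a, b). \<bar>(p (f a + b) - a) * b\<bar>)"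
      using integrable_abs[OF i3] by (simp add: case_prod_unfold)
    show "AE w in ?P. (\<lambda>k. case w of (a, b) \<Rightarrow>
        (p (f a + b) - a) * (clamp k (f a + b) - clamp k (f a)))
        \<longlonglongrightarrow> (case w of (a, b) \<Rightarrow> (p (f a + b) - a) * b)"
    proof (rule AE_I2)
      fix w
      show "(\<lambda>k. case w of (a, b) \<Rightarrow> (p (f a + b) - a) * (clamp k (f a + b) - clamp k (f a)))
        \<longlonglongrightarrow> (case w of (a, b) \<Rightarrow> (p (f a + b) - a) * b)"
        by (cases w) (auto intro!: tendsto_eq_intros clamp_tendsto)
    qed
    show "AE w in ?P. norm (case w of (a, b) \<Rightarrow>
        (p (f a + b) - a) * (clamp k (f a + b) - clamp k (f a)))
        \<le> (case w of (a, b) \<Rightarrow> \<bar>(p (f a + b) - a) * b\<bar>)" for k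
      by (auto simp: abs_mult intro!: AE_I2 mult_left_mono clamp_lipschitz)
  qed measurable
  moreover have "(\<integral>(a, b). (p (f a + b) - a) * b \<partial>?P) = (\<integral>a. S a \<partial>gauss)"
  proof -
    have "(\<integral>(a, b). (p (f a + b) - a) * b \<partial>?P) = (\<integral>a. (\<integral>b. (p (f a + b) - a) * b \<partial>gauss) \<partial>gauss)"
      using gauss2.integral_fst'[OF i3] by simp
    also have "\<dots> = (\<integral>a. S a \<partial>gauss)"
    proof (rule integral_cong_AE)
      show "AE a in gauss. (\<integral>b. (p (f a + b) - a) * b \<partial>gauss) = S a"
        using AE_price_L2
      proof eventually_elim
        case (elim a)
        have "integrable gauss (\<lambda>b. b * p (f a + b))"
          by (rule square_integrable_mult[OF gauss_square_integrable_id elim])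
        moreover have "(\<lambda>b. (p (f a + b) - a) * b) = (\<lambda>b. b * p (f a + b) - a * b)"
          by (auto simp: algebra_simps)
        ultimately show ?case
          using gauss.integrable_if_square_integrable[OF gauss_square_integrable_id]
          by (simp add: S_def gauss_mean)
      qed
    qed simp_all
    finally show ?thesis .
  qed
  ultimately have lim: "(\<lambda>k. \<integral>a. (a - G a) * clamp k (f a) \<partial>gauss) \<longlonglongrightarrow> (\<integral>a. S a \<partial>gauss)"
    unfolding lhs by simp
  have mono: "AE a in gauss. mono (\<lambda>k. (a - G a) * clamp k (f a))"
    using AE_nondegenerate
  proof eventually_elim
    case (elim a)
    then have e: "a - G a = f a * S a" and s: "0 < S a"
      by (auto simp: nondegenerate_def first_order_condition)
    show ?case
    proof (rule monoI)
      fix j k :: nat assume "j \<le> k"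
      from mult_left_mono[OF clamp_mult_mono[OF this, of "f a"], of "S a"] s
      show "(a - G a) * clamp j (f a) \<le> (a - G a) * clamp k (f a)"
        unfolding e by (simp add: mult_ac)
    qed
  qed
  have ptw: "AE a in gauss. (\<lambda>k. (a - G a) * clamp k (f a)) \<longlonglongrightarrow> W a"
    using AE_regular
  proof eventually_elim
    case (elim a)
    then show ?case unfolding W_eq_profit[OF elim]
      by (intro tendsto_intros clamp_tendsto)
  qed
  show "integrable gauss W" "(\<integral>a. W a \<partial>gauss) = (\<integral>a. S a \<partial>gauss)"
    using integrable_monotone_convergence[OF lhs_int mono ptw lim]
      integral_monotone_convergence[OF lhs_int mono ptw lim] by simp_all
qed

section \<open>The Stein inequality\<close>

definition u :: "real \<Rightarrow> real" where "u a = sqrt (2 * S a)"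

text \<open>The signed square root of \<open>2 W\<close>; it is the identity in the linear equilibrium.\<close>
definition z :: "real \<Rightarrow> real" where "z a = f a * u a"

lemma u_measurable [measurable]: "u \<in> borel_measurable borel"
  unfolding u_def by measurable

lemma z_measurable [measurable]: "z \<in> borel_measurable borel"
  unfolding z_def by measurable

lemma nondegenerate_u: "nondegenerate a \<Longrightarrow> 0 < u a" "nondegenerate a \<Longrightarrow> (u a)\<^sup>2 = 2 * S a"
  by (auto simp: nondegenerate_def u_def)

lemma nondegenerate_z: assumes "nondegenerate a" shows "(z a)\<^sup>2 = 2 * W a" "\<bar>z a\<bar> = sqrt (2 * W a)" "z a \<noteq> 0"
proof -
  show 1: "(z a)\<^sup>2 = 2 * W a"
    using nondegenerate_u(2)[OF assms] by (simp add: z_def W_def power_mult_distrib)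
  show "\<bar>z a\<bar> = sqrt (2 * W a)"
    using 1 by (metis real_sqrt_abs)
  show "z a \<noteq> 0" using nondegenerate_u(1)[OF assms] assms by (auto simp: z_def nondegenerate_def)
qed

lemma z_L2: "square_integrable gauss z"
proof -
  have "AE a in gauss. 2 * W a = (z a)\<^sup>2"
    using AE_nondegenerate by eventually_elim (simp add: nondegenerate_z)
  moreover have "integrable gauss (\<lambda>a. 2 * W a)"
    using value_integral(1) by simp
  ultimately have "integrable gauss (\<lambda>a. (z a)\<^sup>2)"
    by (subst (asm) integrable_cong_AE) auto
  then show ?thesis by (simp add: square_integrable_def)
qed

text \<open>
  The slope \<open>f a\<close> bounds \<open>W\<close> from below at other points. On the part where \<open>f > 0\<close> this controls
  increments of \<open>z\<close> to the right, on the part where \<open>f < 0\<close> increments to the left. The two parts are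
  therefore shifted in opposite directions.
\<close>
definition z_pos :: "real \<Rightarrow> real" where "z_pos a = (if 0 < f a then \<bar>z a\<bar> else 0)"

definition z_neg :: "real \<Rightarrow> real" where "z_neg a = (if f a < 0 then \<bar>z a\<bar> else 0)"

lemma z_pos_measurable [measurable]: "z_pos \<in> borel_measurable borel"
  unfolding z_pos_def by measurable

lemma z_neg_measurable [measurable]: "z_neg \<in> borel_measurable borel"
  unfolding z_neg_def by measurable

lemma z_pos_L2: "square_integrable gauss z_pos" and z_neg_L2: "square_integrable gauss z_neg"
  by (rule square_integrable_bound[OF z_L2]; simp add: z_pos_def z_neg_def)+

lemma nondegenerate_z_decomp: "nondegenerate a \<Longrightarrow> z a = z_pos a - z_neg a"
  using nondegenerate_u(1)[of a] by (auto simp: z_pos_def z_neg_def z_def nondegenerate_def abs_mult)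

lemma z_abs_growth:
  assumes "nondegenerate a" "nondegenerate (a + s)"
  shows "sqrt ((z a)\<^sup>2 + 2 * (f a * s)) \<le> \<bar>z (a + s)\<bar>"
  unfolding nondegenerate_z(1)[OF assms(1)] nondegenerate_z(2)[OF assms(2)]
  using W_subgradient[of a "a + s"] assms by (auto simp: nondegenerate_def)

text \<open>
  One of \<open>z_pos a\<close> and \<open>z_neg a\<close> is \<open>0\<close>, so its increment is nonnegative. For the other one the shift goes
  in the direction in which the monotone function \<open>f\<close> keeps its sign, and the subgradient inequality
  bounds the growth of \<open>\<bar>z\<bar> = sqrt (2 W)\<close>.
\<close>
lemma z_increments:
  assumes n: "nondegenerate a" "nondegenerate (a + h)" "nondegenerate (a - h)" and h: "0 < h"
  shows "sqrt ((z a)\<^sup>2 + 2 * (\<bar>f a\<bar> * h)) - \<bar>z a\<bar>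
    \<le> (z_pos (a + h) - z_pos a) + (z_neg (a - h) - z_neg a)"
proof (cases "0 < f a")
  case True
  then have "0 < f (a + h)"
    using f_mono[of a "a + h"] n h by (auto simp: nondegenerate_def)
  then show ?thesis
    using True z_abs_growth[OF n(1,2)] by (auto simp: z_pos_def z_neg_def)
next
  case False
  then have "f a < 0" using n by (auto simp: nondegenerate_def)
  moreover from this have "f (a - h) < 0"
    using f_mono[of "a - h" a] n h by (auto simp: nondegenerate_def)
  ultimately show ?thesis
    using z_abs_growth[of a "- h"] n by (auto simp: z_pos_def z_neg_def)
qed

text \<open>
  Integration by parts for the increasing function \<open>z\<close>. The integrals of its difference quotients \<open>d n\<close>
  converge to \<open>E (a z)\<close>, since a shift of the argument only affects the Gaussian weight. The quotients
  are bounded below by nonnegative functions \<open>e n\<close> that converge to \<open>f / z = 1 / u\<close>, so Fatou's lemma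
  gives the inequality. Jumps of \<open>z\<close> would make it strict.
\<close>
lemma stein_inequality:
  "integrable gauss (\<lambda>a. 1 / u a)" "(\<integral>a. 1 / u a \<partial>gauss) \<le> (\<integral>a. a * z a \<partial>gauss)"
proof -
  define h where "h n = 1 / real (Suc n)" for n
  have h_pos: "0 < h n" for n by (simp add: h_def)
  have h_lim: "h \<longlonglongrightarrow> 0" unfolding h_def by (rule LIMSEQ_Suc[OF lim_1_over_n])
  define e where "e n a = 2 * \<bar>f a\<bar> / (sqrt ((z a)\<^sup>2 + 2 * (\<bar>f a\<bar> * h n)) + \<bar>z a\<bar>)" for n a
  define d where "d n a = (z_pos (a + h n) - z_pos a) / h n + (z_neg (a + - h n) - z_neg a) / h n" for n a
  have [measurable]: "e n \<in> borel_measurable borel" for n unfolding e_def by measurable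
  have e_nonneg: "0 \<le> e n a" for n a
    unfolding e_def using h_pos[of n] by (intro divide_nonneg_nonneg add_nonneg_nonneg) auto
  have d_int: "integrable gauss (d n)" for n
    unfolding d_def
    by (intro Bochner_Integration.integrable_add Bochner_Integration.integrable_diff
        integrable_divide gauss_shift_derivative(1) z_pos_L2 z_neg_L2
        gauss.integrable_if_square_integrable)
  have d_lim: "(\<lambda>n. \<integral>a. d n a \<partial>gauss) \<longlonglongrightarrow> (\<integral>a. a * z a \<partial>gauss)"
  proof -
    have "(\<integral>a. d n a \<partial>gauss) =
      (\<integral>a. (z_pos (a + 1 / real (Suc n)) - z_pos a) / (1 / real (Suc n)) \<partial>gauss)
      - (\<integral>a. (z_neg (a + - 1 / real (Suc n)) - z_neg a) / (- 1 / real (Suc n)) \<partial>gauss)" for n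
    proof -
      have "(\<integral>a. d n a \<partial>gauss) = (\<integral>a. (z_pos (a + h n) - z_pos a) / h n \<partial>gauss)
          + (\<integral>a. (z_neg (a + - h n) - z_neg a) / h n \<partial>gauss)"
        unfolding d_def
        by (intro Bochner_Integration.integral_add integrable_divide Bochner_Integration.integrable_diff
          gauss_shift_derivative(1) z_pos_L2 z_neg_L2 gauss.integrable_if_square_integrable)
      also have "(\<integral>a. (z_neg (a + - h n) - z_neg a) / h n \<partial>gauss) =
          - (\<integral>a. (z_neg (a + - h n) - z_neg a) / (- h n) \<partial>gauss)"
        by (subst integral_minus[symmetric]) simp
      finally show ?thesis by (simp add: h_def del: of_nat_Suc)
    qed
    moreover have "(\<integral>a. a * z a \<partial>gauss) = (\<integral>a. a * z_pos a \<partial>gauss) - (\<integral>a. a * z_neg a \<partial>gauss)"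
    proof -
      have "(\<integral>a. a * z a \<partial>gauss) = (\<integral>a. a * z_pos a - a * z_neg a \<partial>gauss)"
        by (rule integral_cong_AE)
          (use AE_nondegenerate in \<open>auto elim!: eventually_mono simp: nondegenerate_z_decomp right_diff_distrib\<close>)
      then show ?thesis
        using square_integrable_mult[OF gauss_square_integrable_id z_pos_L2]
          square_integrable_mult[OF gauss_square_integrable_id z_neg_L2] by simp
    qed
    ultimately show ?thesis
      using tendsto_diff[OF gauss_shift_quotients[OF z_pos_L2, of 1] gauss_shift_quotients[OF z_neg_L2, of "-1"]]
      by simp
  qed
  have e_le_d: "AE a in gauss. e n a \<le> d n a" for n
    using AE_nondegenerate AE_gauss_shift[OF AE_nondegenerate, of "h n"] AE_gauss_shift[OF AE_nondegenerate, of "- h n"]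
  proof eventually_elim
    case (elim a)
    \<comment> \<open>Rationalising the difference of square roots shows that \<open>e n\<close> is the lower bound of \<open>z_increments\<close>.\<close>
    define A where "A = sqrt ((z a)\<^sup>2 + 2 * (\<bar>f a\<bar> * h n))"
    have A: "0 < A + \<bar>z a\<bar>" "A\<^sup>2 = (z a)\<^sup>2 + 2 * (\<bar>f a\<bar> * h n)"
      using nondegenerate_z(3)[OF elim(1)] h_pos[of n] by (auto simp: A_def intro!: add_nonneg_pos)
    have "(A - \<bar>z a\<bar>) * (A + \<bar>z a\<bar>) = 2 * \<bar>f a\<bar> * h n"
    proof -
      have "(A - \<bar>z a\<bar>) * (A + \<bar>z a\<bar>) = A\<^sup>2 - (z a)\<^sup>2"
        by (simp add: power2_eq_square algebra_simps)
      then show ?thesis using A(2) by simp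
    qed
    then have "e n a = (A - \<bar>z a\<bar>) / h n"
      unfolding e_def A_def[symmetric] using A(1) h_pos[of n] by (simp add: field_simps)
    also have "\<dots> \<le> d n a"
      using z_increments[of a "h n"] elim h_pos[of n] unfolding d_def A_def
      by (simp add: add_divide_distrib[symmetric] divide_right_mono)
    finally show ?case .
  qed
  have e_lim: "AE a in gauss. (\<lambda>n. e n a) \<longlonglongrightarrow> 1 / u a"
    using AE_nondegenerate
  proof eventually_elim
    case (elim a)
    have "(\<lambda>n. e n a) \<longlonglongrightarrow> 2 * \<bar>f a\<bar> / (sqrt ((z a)\<^sup>2 + 2 * (\<bar>f a\<bar> * 0)) + \<bar>z a\<bar>)"
      unfolding e_def using nondegenerate_z(3)[OF elim] by (intro tendsto_intros h_lim) auto
    also have "sqrt ((z a)\<^sup>2 + 2 * (\<bar>f a\<bar> * 0)) = \<bar>z a\<bar>" by simp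
    also have "2 * \<bar>f a\<bar> / (\<bar>z a\<bar> + \<bar>z a\<bar>) = 1 / u a"
      using elim nondegenerate_u(1)[OF elim] by (simp add: z_def abs_mult nondegenerate_def field_simps)
    finally show ?case .
  qed
  have "(\<integral>\<^sup>+a. ennreal (1 / u a) \<partial>gauss) = (\<integral>\<^sup>+a. liminf (\<lambda>n. ennreal (e n a)) \<partial>gauss)"
  proof (rule nn_integral_cong_AE)
    show "AE a in gauss. ennreal (1 / u a) = liminf (\<lambda>n. ennreal (e n a))"
      using e_lim
    proof eventually_elim
      case (elim a)
      then have "(\<lambda>n. ennreal (e n a)) \<longlonglongrightarrow> ennreal (1 / u a)" by (rule tendsto_ennrealI)
      from lim_imp_Liminf[OF _ this] show ?case by simp
    qed
  qed
  also have "\<dots> \<le> liminf (\<lambda>n. \<integral>\<^sup>+a. ennreal (e n a) \<partial>gauss)"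
    by (rule nn_integral_liminf) simp
  also have "\<dots> \<le> liminf (\<lambda>n. ennreal (\<integral>a. d n a \<partial>gauss))"
  proof (rule Liminf_mono[OF always_eventually], rule allI)
    fix n
    have "AE a in gauss. 0 \<le> d n a"
      using e_le_d[of n] by eventually_elim (use e_nonneg[of n] order_trans in blast)
    then have "ennreal (\<integral>a. d n a \<partial>gauss) = (\<integral>\<^sup>+a. ennreal (d n a) \<partial>gauss)"
      by (rule nn_integral_eq_integral[OF d_int, symmetric])
    moreover have "(\<integral>\<^sup>+a. ennreal (e n a) \<partial>gauss) \<le> (\<integral>\<^sup>+a. ennreal (d n a) \<partial>gauss)"
      using e_le_d[of n] by (intro nn_integral_mono_AE) (auto elim!: eventually_mono intro: ennreal_leI)
    ultimately show "(\<integral>\<^sup>+a. ennreal (e n a) \<partial>gauss) \<le> ennreal (\<integral>a. d n a \<partial>gauss)" by simp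
  qed
  also have "\<dots> = ennreal (\<integral>a. a * z a \<partial>gauss)"
    using lim_imp_Liminf[OF _ tendsto_ennrealI[OF d_lim]] by simp
  finally have le: "(\<integral>\<^sup>+a. ennreal (1 / u a) \<partial>gauss) \<le> ennreal (\<integral>a. a * z a \<partial>gauss)" .
  have nn: "AE a in gauss. 0 \<le> 1 / u a"
    using AE_nondegenerate by eventually_elim (simp add: nondegenerate_u less_imp_le)
  show int: "integrable gauss (\<lambda>a. 1 / u a)"
    by (rule integrableI_nonneg[OF _ nn]) (use le in \<open>auto intro: le_less_trans\<close>)
  have "0 \<le> (\<integral>a. d n a \<partial>gauss)" for n
    by (rule integral_nonneg_AE)
      (use e_le_d[of n] e_nonneg[of n] in \<open>auto elim!: eventually_mono intro: order_trans\<close>)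
  then have "0 \<le> (\<integral>a. a * z a \<partial>gauss)"
    by (intro LIMSEQ_le_const[OF d_lim]) auto
  then show "(\<integral>a. 1 / u a \<partial>gauss) \<le> (\<integral>a. a * z a \<partial>gauss)"
    using le nn_integral_eq_integral[OF int nn] by simp
qed

section \<open>Uniqueness of strategy and price\<close>

text \<open>
  The expression \<open>R\<close> collects the three integral relations and has integral at most \<open>0\<close>; \<open>Q\<close> is
  the same function written as a sum of nonnegative terms. Terms in \<open>G\<close> are matched through
  \<open>z u = 2 f S = 2 (a - G)\<close>, and the remaining function of \<open>u\<close> alone is
  \<open>u\<^sup>4 / 2 - u\<^sup>2 / 2 - 1 + 1 / u\<close>, which has a double zero at \<open>u = 1\<close>.
\<close>
lemma strategy_eq: "AE a in gauss. f a = a"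
proof -
  define Q where "Q a = (z a * u a - a)\<^sup>2 / 2 + (z a - a)\<^sup>2 / 2
      + (u a - 1)\<^sup>2 * ((u a) ^ 3 + 2 * (u a)\<^sup>2 + 2 * u a + 2) / (2 * u a)" for a
  define R where "R a = (a\<^sup>2 - 1) + 2 * ((G a)\<^sup>2 + (S a)\<^sup>2 - a * G a) + (W a - S a)
      + (1 / u a - a * z a)" for a
  have QR: "Q a = R a" if "nondegenerate a" for a
  proof -
    have u: "0 < u a" "(u a)\<^sup>2 = 2 * S a" using nondegenerate_u that by auto
    have zu: "z a * u a = 2 * (a - G a)"
      using first_order_condition[of a] that u by (simp add: z_def nondegenerate_def power2_eq_square)
    have q1: "(z a * u a - a)\<^sup>2 / 2 = a\<^sup>2 / 2 - 2 * (a * G a) + 2 * (G a)\<^sup>2"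
      unfolding zu by (simp add: power2_eq_square field_simps)
    have q2: "(z a - a)\<^sup>2 / 2 = W a - a * z a + a\<^sup>2 / 2"
      using nondegenerate_z(1)[OF that] by (simp add: power2_diff field_simps)
    have q3: "(u a - 1)\<^sup>2 * ((u a) ^ 3 + 2 * (u a)\<^sup>2 + 2 * u a + 2) / (2 * u a)
        = (2 * S a)\<^sup>2 / 2 - (2 * S a) / 2 - 1 + 1 / u a"
      unfolding u(2)[symmetric] using u(1) by (simp add: power2_eq_square power3_eq_cube field_simps)
    show ?thesis unfolding Q_def R_def q1 q2 q3 by (simp add: power_mult_distrib)
  qed
  have Q_nonneg: "AE a in gauss. 0 \<le> Q a"
    using AE_nondegenerate
  proof eventually_elim
    case (elim a)
    then show ?case unfolding Q_def using nondegenerate_u(1)[OF elim]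
      by (intro add_nonneg_nonneg divide_nonneg_nonneg mult_nonneg_nonneg) auto
  qed
  note ints = gauss_square_integrable_id[unfolded square_integrable_def, THEN conjunct2]
    G_L2[unfolded square_integrable_def, THEN conjunct2]
    S_L2[unfolded square_integrable_def, THEN conjunct2]
    square_integrable_mult[OF gauss_square_integrable_id G_L2]
    square_integrable_mult[OF gauss_square_integrable_id z_L2]
    gauss.integrable_if_square_integrable[OF S_L2] value_integral(1) stein_inequality(1)
  have R_int: "integrable gauss R" unfolding R_def using ints by simp
  have [measurable]: "Q \<in> borel_measurable borel" unfolding Q_def by measurable
  have [measurable]: "R \<in> borel_measurable borel" unfolding R_def by measurable
  have QR_AE: "AE a in gauss. R a = Q a" using AE_nondegenerate by eventually_elim (simp add: QR)
  have Q_int: "integrable gauss Q"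
    using R_int QR_AE by (subst (asm) integrable_cong_AE) auto
  have "(\<integral>a. Q a \<partial>gauss) = (\<integral>a. R a \<partial>gauss)"
    using QR_AE by (intro integral_cong_AE) (auto elim!: eventually_mono)
  also have "\<dots> = 2 * ((\<integral>a. (G a)\<^sup>2 + (S a)\<^sup>2 \<partial>gauss) - (\<integral>a. a * G a \<partial>gauss))
      + ((\<integral>a. 1 / u a \<partial>gauss) - (\<integral>a. a * z a \<partial>gauss))"
    unfolding R_def using ints value_integral(2)
    by (simp add: gauss_variance gauss.prob_space[simplified])
  also have "\<dots> \<le> 0" using energy_inequality stein_inequality(2) by simp
  finally have "(\<integral>a. Q a \<partial>gauss) = 0"
    using integral_nonneg_AE[OF Q_nonneg] by simp
  then have "AE a in gauss. Q a = 0"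
    using integral_nonneg_eq_0_iff_AE[OF Q_int Q_nonneg] by simp
  then show ?thesis using AE_nondegenerate
  proof eventually_elim
    case (elim a)
    have u: "0 < u a" using nondegenerate_u elim by auto
    define T1 T2 T3 where "T1 = (z a * u a - a)\<^sup>2 / 2" and "T2 = (z a - a)\<^sup>2 / 2"
      and "T3 = (u a - 1)\<^sup>2 * ((u a) ^ 3 + 2 * (u a)\<^sup>2 + 2 * u a + 2) / (2 * u a)"
    have "0 \<le> T1" "0 \<le> T2" by (auto simp: T1_def T2_def)
    moreover have pos: "0 < (u a) ^ 3 + 2 * (u a)\<^sup>2 + 2 * u a + 2"
      using u by (intro add_pos_pos) auto
    then have "0 \<le> T3" unfolding T3_def using u by (intro divide_nonneg_nonneg mult_nonneg_nonneg) auto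
    ultimately have "T2 = 0" "T3 = 0"
      using elim(1) unfolding Q_def T1_def[symmetric] T2_def[symmetric] T3_def[symmetric] by linarith+
    then have "z a = a" "u a = 1" using u pos by (auto simp: T2_def T3_def)
    then show ?case by (simp add: z_def)
  qed
qed

text \<open>
  With \<open>D y = p y - y / 2\<close>, exchanging the coordinates gives \<open>E (a D (a + b)) = E ((a + b) / 2 D (a + b))\<close>.
  Efficiency replaces the left-hand side by \<open>E (p (a + b) D (a + b))\<close>, so \<open>E (D (a + b))\<^sup>2 = 0\<close>.
\<close>
lemma pricing_eq: "AE (a, b) in gauss \<Otimes>\<^sub>M gauss. p (f a + b) = (f a + b) / 2"
proof -
  let ?P = "gauss \<Otimes>\<^sub>M gauss"
  define D where "D y = p y - y / 2" for y
  have [measurable]: "D \<in> borel_measurable borel" unfolding D_def by measurable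
  have f_eq: "AE w in ?P. f (fst w) = fst w"
    by (rule AE_gauss_pair_fst[OF strategy_eq])
  note a2 = gauss_pair_coordinates_square_integrable(1) and b2 = gauss_pair_coordinates_square_integrable(2)
  have s2: "square_integrable ?P (\<lambda>w. (fst w + snd w) / 2)"
    using square_integrable_cmult[OF square_integrable_add[OF a2 b2], of "1/2"] by simp
  have p2: "square_integrable ?P (\<lambda>w. p (fst w + snd w))"
    by (rule square_integrable_bound[OF price_L2])
      (use f_eq in \<open>auto elim!: eventually_mono simp: case_prod_unfold\<close>)
  have D2: "square_integrable ?P (\<lambda>w. D (fst w + snd w))"
    using square_integrable_diff[OF p2 s2] by (simp add: D_def)
  have D2': "square_integrable ?P (\<lambda>(a, b). D (f a + b))"
    by (rule square_integrable_bound[OF D2])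
      (use f_eq in \<open>auto elim!: eventually_mono simp: case_prod_unfold\<close>)
  note ints = square_integrable_mult[OF a2 D2] square_integrable_mult[OF b2 D2]
    square_integrable_mult[OF p2 D2]
  have swap: "(\<integral>w. snd w * D (fst w + snd w) \<partial>?P) = (\<integral>w. fst w * D (fst w + snd w) \<partial>?P)"
    using gauss2.integral_product_swap[of "\<lambda>w. fst w * D (fst w + snd w)"]
    by (simp add: case_prod_unfold add.commute)
  have "(\<integral>w. fst w * D (fst w + snd w) \<partial>?P) = (\<integral>(a, b). a * D (f a + b) \<partial>?P)"
    using f_eq by (intro integral_cong_AE) (auto elim!: eventually_mono simp: case_prod_unfold)
  also have "\<dots> = (\<integral>(a, b). p (f a + b) * D (f a + b) \<partial>?P)"
    by (rule efficient[OF _ D2']) simp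
  also have "\<dots> = (\<integral>w. p (fst w + snd w) * D (fst w + snd w) \<partial>?P)"
    using f_eq by (intro integral_cong_AE) (auto elim!: eventually_mono simp: case_prod_unfold)
  finally have key: "(\<integral>w. fst w * D (fst w + snd w) \<partial>?P) = (\<integral>w. p (fst w + snd w) * D (fst w + snd w) \<partial>?P)" .
  have "(\<lambda>w. (D (fst w + snd w))\<^sup>2) = (\<lambda>w. p (fst w + snd w) * D (fst w + snd w)
      - (fst w * D (fst w + snd w) + snd w * D (fst w + snd w)) / 2)"
    by (auto simp: D_def power2_eq_square field_simps)
  then have "(\<integral>w. (D (fst w + snd w))\<^sup>2 \<partial>?P) = 0"
    using ints swap key by simp
  then have "AE w in ?P. (D (fst w + snd w))\<^sup>2 = 0"
    using D2 by (subst (asm) integral_nonneg_eq_0_iff_AE) (auto simp: square_integrable_def)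
  then show ?thesis using f_eq
    by eventually_elim (auto simp: D_def case_prod_unfold)
qed

end

section \<open>Reduction to the normalised model\<close>

text \<open>
  With \<open>V = \<mu> + \<tau> a\<close>, \<open>U = \<sigma> b\<close>, \<open>\<phi> (\<mu> + \<tau> a) = \<sigma> f a\<close> and \<open>P (\<sigma> y) = \<mu> + \<tau> p y\<close> the order flow is
  multiplied by \<open>\<sigma>\<close> and every expected profit by \<open>\<tau> \<sigma>\<close>, so both equilibrium conditions carry over to
  the normalised model.
\<close>
theorem lemmaB1:
  fixes M :: "'a measure"
    and V U :: "'a \<Rightarrow> real"
    and \<mu> \<tau> \<sigma> :: real
    and \<phi> P :: "real \<Rightarrow> real"
  assumes "prob_space M"
    and "\<tau> > 0" and "\<sigma> > 0"
    and "distributed M lborel V (normal_density \<mu> \<tau>)"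
    and "distributed M lborel U (normal_density 0 \<sigma>)"
    and "prob_space.indep_var M borel V borel U"
    and "\<phi> \<in> borel_measurable borel" and "P \<in> borel_measurable borel"
    and "quasi_equilibrium M V U \<phi> P"
  shows "let Y = order_flow V U \<phi>;
             l = covariance M V Y / prob_space.variance M Y
         in (AE v in lborel. \<phi> v = \<sigma> / \<tau> * (v - \<mu>)) \<and>
            (AE \<omega> in M. P (Y \<omega>) = \<mu> + l * Y \<omega>) \<and>
            l = \<tau> / (2 * \<sigma>)"
proof -
  interpret prob_space M by fact
  note [measurable] = \<open>\<phi> \<in> borel_measurable borel\<close> \<open>P \<in> borel_measurable borel\<close>
  have \<tau>: "0 < \<tau>" "\<tau> \<noteq> 0" and \<sigma>: "0 < \<sigma>" "\<sigma> \<noteq> 0" using assms by auto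
  let ?P = "gauss \<Otimes>\<^sub>M gauss"
  have [measurable]: "V \<in> borel_measurable M" "U \<in> borel_measurable M"
    using distributed_measurable[OF assms(4)] distributed_measurable[OF assms(5)] by auto
  define V' where "V' = (\<lambda>\<omega>. (V \<omega> - \<mu>) / \<tau>)"
  define U' where "U' = (\<lambda>\<omega>. U \<omega> / \<sigma>)"
  define T where "T = (\<lambda>\<omega>. (V' \<omega>, U' \<omega>))"
  define f where "f = (\<lambda>a. \<phi> (\<mu> + \<tau> * a) / \<sigma>)"
  define p where "p = (\<lambda>y. (P (\<sigma> * y) - \<mu>) / \<tau>)"
  define Y where "Y = order_flow V U \<phi>"
  have [measurable]: "V' \<in> borel_measurable M" "U' \<in> borel_measurable M"
    "f \<in> borel_measurable borel" "p \<in> borel_measurable borel"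
    unfolding V'_def U'_def f_def p_def by measurable
  have T_measurable [measurable]: "T \<in> measurable M ?P"
    unfolding T_def by measurable
  have [measurable]: "(\<lambda>\<omega>. fst (T \<omega>)) \<in> borel_measurable M" "(\<lambda>\<omega>. snd (T \<omega>)) \<in> borel_measurable M"
    by (simp_all add: T_def)
  have Y_def': "Y = (\<lambda>\<omega>. \<phi> (V \<omega>) + U \<omega>)" by (auto simp: Y_def order_flow_def)
  have [measurable]: "Y \<in> borel_measurable M" unfolding Y_def' by measurable
  have V_eq: "V \<omega> = \<mu> + \<tau> * V' \<omega>" and U_eq: "U \<omega> = \<sigma> * U' \<omega>" for \<omega>
    using \<tau> \<sigma> by (auto simp: V'_def U'_def)
  have Y_eq: "Y \<omega> = \<sigma> * (f (V' \<omega>) + U' \<omega>)" for \<omega>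
    using \<sigma> unfolding Y_def' V_eq U_eq f_def by (simp add: distrib_left)
  have P_eq: "P (\<sigma> * y) = \<mu> + \<tau> * p y" for y using \<tau> by (simp add: p_def)
  have Y_scaled: "Y \<omega> / \<sigma> = f (V' \<omega>) + U' \<omega>"
    and PY_eq: "P (Y \<omega>) = \<mu> + \<tau> * p (f (V' \<omega>) + U' \<omega>)" for \<omega>
    using \<sigma> by (simp_all add: Y_eq P_eq)

  have dV: "distr M borel V' = gauss"
  proof -
    have "distributed M lborel V' std_normal_density"
      using assms(4) normal_standard_normal_convert[OF \<tau>(1), of V \<mu>] by (simp add: V'_def)
    then have "distr M lborel V' = gauss"
      unfolding gauss_def by (rule distributed_distr_eq_density)
    then show ?thesis by (metis distr_cong sets_lborel)
  qed
  have dU: "distr M borel U' = gauss"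
  proof -
    have "distributed M lborel U' std_normal_density"
      using assms(5) normal_standard_normal_convert[OF \<sigma>(1), of U 0] by (simp add: U'_def)
    then have "distr M lborel U' = gauss"
      unfolding gauss_def by (rule distributed_distr_eq_density)
    then show ?thesis by (metis distr_cong sets_lborel)
  qed
  \<comment> \<open>The pair of normalised variables has the law on which the normalised model lives.\<close>
  have dT: "distr M ?P T = ?P"
  proof -
    have "indep_var borel ((\<lambda>v. (v - \<mu>) / \<tau>) \<circ> V) borel ((\<lambda>x. x / \<sigma>) \<circ> U)"
      by (rule indep_var_compose[OF assms(6)]) measurable
    then have "indep_var borel V' borel U'" by (simp add: V'_def U'_def comp_def)
    then have "distr M borel V' \<Otimes>\<^sub>M distr M borel U' = distr M (borel \<Otimes>\<^sub>M borel) T"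
      unfolding indep_var_distribution_eq T_def by simp
    also have "\<dots> = distr M ?P T"
      by (rule distr_cong) (auto intro!: sets_pair_measure_cong)
    finally show ?thesis unfolding dV dU by simp
  qed
  have int_T: "(\<integral>\<omega>. h (T \<omega>) \<partial>M) = (\<integral>w. h w \<partial>?P)"
    and integrable_T: "integrable M (\<lambda>\<omega>. h (T \<omega>)) \<longleftrightarrow> integrable ?P h"
    if "h \<in> borel_measurable ?P" for h :: "real \<times> real \<Rightarrow> real"
    using integral_distr[OF T_measurable that] integrable_distr_eq[OF T_measurable that]
    by (simp_all add: dT)
  have AE_T: "AE \<omega> in M. Q (T \<omega>)" if "AE w in ?P. Q w" for Q
  proof -
    have "AE w in distr M ?P T. Q w" using that by (simp only: dT)
    then show ?thesis by (rule AE_distrD[OF T_measurable])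
  qed

  define F where "F = vimage_algebra (space M) Y borel"
  have YF [measurable]: "Y \<in> measurable F borel"
    unfolding F_def by (rule measurable_vimage_algebra1) simp
  have subalg: "subalgebra M F"
    unfolding subalgebra_def F_def
    by (auto simp: sets_vimage_algebra2)
  interpret F: finite_measure_subalgebra M F
    by unfold_locales (rule subalg)
  have eff: "AE \<omega> in M. P (Y \<omega>) = real_cond_exp M F V \<omega>"
    using assms(9) unfolding quasi_equilibrium_def market_efficient_def F_def Y_def by simp
  have V2: "square_integrable M V"
  proof -
    have "square_integrable ?P (\<lambda>(a, b). \<mu> + \<tau> * a)"
      by (rule square_integrable_fst)
        (intro square_integrable_add square_integrable_cmult gauss_square_integrable_id
          gauss.square_integrable_const)
    then have "integrable M (\<lambda>\<omega>. (\<mu> + \<tau> * fst (T \<omega>))\<^sup>2)"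
      by (subst integrable_T) (auto simp: square_integrable_def case_prod_unfold)
    then show ?thesis by (simp add: square_integrable_def V_eq T_def)
  qed
  \<comment> \<open>Jensen's inequality for the conditional expectation.\<close>
  have PY2: "square_integrable M (\<lambda>\<omega>. P (Y \<omega>))"
  proof -
    have "integrable M (\<lambda>\<omega>. (real_cond_exp M F V \<omega>)\<^sup>2)"
      by (rule F.integrable_convex_cond_exp[where I = UNIV])
        (use V2 integrable_if_square_integrable[OF V2] in
          \<open>auto simp: square_integrable_def intro!: convex_power2\<close>)
    then have "integrable M (\<lambda>\<omega>. (P (Y \<omega>))\<^sup>2)"
      using eff by (subst integrable_cong_AE[where g = "\<lambda>\<omega>. (real_cond_exp M F V \<omega>)\<^sup>2"])
        (auto elim!: eventually_mono)
    then show ?thesis by (simp add: square_integrable_def)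
  qed

  have p2: "square_integrable ?P (\<lambda>(a, b). p (f a + b))"
  proof -
    have "square_integrable M (\<lambda>\<omega>. (1 / \<tau>) * (P (Y \<omega>) - \<mu>))"
      by (intro square_integrable_cmult square_integrable_diff PY2 square_integrable_const)
    then have "integrable M (\<lambda>\<omega>. (p (f (fst (T \<omega>)) + snd (T \<omega>)))\<^sup>2)"
      unfolding Y_eq P_eq using \<tau> by (simp add: square_integrable_def T_def)
    then show ?thesis
      by (subst (asm) integrable_T) (auto simp: square_integrable_def case_prod_unfold)
  qed

  interpret K: standard_kyle f p
  proof
    show "square_integrable ?P (\<lambda>(a, b). p (f a + b))" by (rule p2)
  next
    fix \<psi> :: "real \<Rightarrow> real"
    assume [measurable]: "\<psi> \<in> borel_measurable borel"
      and psi2: "square_integrable ?P (\<lambda>(a, b). \<psi> (f a + b))"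
    have "integrable M (\<lambda>\<omega>. (\<psi> (f (fst (T \<omega>)) + snd (T \<omega>)))\<^sup>2)"
      using psi2 by (subst integrable_T) (auto simp: square_integrable_def case_prod_unfold)
    then have psi_Y2: "square_integrable M (\<lambda>\<omega>. \<psi> (Y \<omega> / \<sigma>))"
      using \<sigma> by (simp add: square_integrable_def T_def Y_eq)
    note i = square_integrable_mult[OF psi_Y2 V2] square_integrable_mult[OF psi_Y2 PY2]
    have "(\<integral>\<omega>. \<psi> (Y \<omega> / \<sigma>) * V \<omega> \<partial>M) = (\<integral>\<omega>. \<psi> (Y \<omega> / \<sigma>) * real_cond_exp M F V \<omega> \<partial>M)"
      by (rule F.real_cond_exp_intg(2)[symmetric]) (use i(1) in measurable)
    also have "\<dots> = (\<integral>\<omega>. \<psi> (Y \<omega> / \<sigma>) * P (Y \<omega>) \<partial>M)"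
      using eff by (intro integral_cong_AE) (auto elim!: eventually_mono)
    finally have "(\<integral>\<omega>. (\<psi> (Y \<omega> / \<sigma>) * V \<omega> - \<psi> (Y \<omega> / \<sigma>) * P (Y \<omega>)) / \<tau> \<partial>M) = 0"
      using i by simp
    also have "(\<lambda>\<omega>. (\<psi> (Y \<omega> / \<sigma>) * V \<omega> - \<psi> (Y \<omega> / \<sigma>) * P (Y \<omega>)) / \<tau>) =
      (\<lambda>\<omega>. (\<lambda>w. fst w * \<psi> (f (fst w) + snd w) - p (f (fst w) + snd w) * \<psi> (f (fst w) + snd w)) (T \<omega>))"
      using \<tau> unfolding V_eq Y_scaled PY_eq by (auto simp: T_def field_simps)
    finally have "(\<integral>w. fst w * \<psi> (f (fst w) + snd w) - p (f (fst w) + snd w) * \<psi> (f (fst w) + snd w) \<partial>?P) = 0"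
      by (subst (asm) int_T) simp_all
    moreover have "integrable ?P (\<lambda>w. fst w * \<psi> (f (fst w) + snd w))"
      "integrable ?P (\<lambda>w. p (f (fst w) + snd w) * \<psi> (f (fst w) + snd w))"
      using square_integrable_mult[OF square_integrable_fst[OF gauss_square_integrable_id] psi2]
        square_integrable_mult[OF p2 psi2] by (simp_all add: case_prod_unfold)
    ultimately show "(\<integral>(a, b). a * \<psi> (f a + b) \<partial>?P) = (\<integral>(a, b). p (f a + b) * \<psi> (f a + b) \<partial>?P)"
      by (simp add: case_prod_unfold)
  next
    have "AE a in lborel. \<forall>x. expected_profit M U P (\<mu> + \<tau> * a) (\<phi> (\<mu> + \<tau> * a))
        \<ge> expected_profit M U P (\<mu> + \<tau> * a) x"
      using assms(9) \<tau>(2) unfolding quasi_equilibrium_def ae_profit_maximising_def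
      by (intro AE_lborel_affine) auto
    moreover have "expected_profit M U P (\<mu> + \<tau> * a) (\<sigma> * x) =
        \<tau> * \<sigma> * (\<integral>b. (a - p (x + b)) * x \<partial>gauss)" for a x
    proof -
      have "expected_profit M U P (\<mu> + \<tau> * a) (\<sigma> * x) = (\<integral>\<omega>. \<tau> * \<sigma> * ((a - p (x + U' \<omega>)) * x) \<partial>M)"
        unfolding expected_profit_def U_eq distrib_left[symmetric] P_eq
        by (simp add: algebra_simps)
      also have "\<dots> = \<tau> * \<sigma> * (\<integral>b. (a - p (x + b)) * x \<partial>distr M borel U')"
        by (subst integral_distr) (simp_all only: integral_mult_right_zero, measurable)
      finally show ?thesis unfolding dU .
    qed
    ultimately show "AE a in gauss. \<forall>x. (\<integral>b. (a - p (x + b)) * x \<partial>gauss)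
      \<le> (\<integral>b. (a - p (f a + b)) * f a \<partial>gauss)"
      unfolding AE_gauss_iff
    proof (elim eventually_mono, intro allI)
      fix a x
      assume opt: "\<forall>x. expected_profit M U P (\<mu> + \<tau> * a) (\<phi> (\<mu> + \<tau> * a))
          \<ge> expected_profit M U P (\<mu> + \<tau> * a) x"
        and eq: "\<And>a x. expected_profit M U P (\<mu> + \<tau> * a) (\<sigma> * x) =
          \<tau> * \<sigma> * (\<integral>b. (a - p (x + b)) * x \<partial>gauss)"
      have "\<phi> (\<mu> + \<tau> * a) = \<sigma> * f a" using \<sigma> by (simp add: f_def)
      then have "expected_profit M U P (\<mu> + \<tau> * a) (\<sigma> * x) \<le> expected_profit M U P (\<mu> + \<tau> * a) (\<sigma> * f a)"
        using opt by simp
      then show "(\<integral>b. (a - p (x + b)) * x \<partial>gauss) \<le> (\<integral>b. (a - p (f a + b)) * f a \<partial>gauss)"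
        unfolding eq using \<tau>(1) \<sigma>(1) by simp
    qed
  qed simp_all

  have "AE v in lborel. f (- \<mu> / \<tau> + 1 / \<tau> * v) = - \<mu> / \<tau> + 1 / \<tau> * v"
    using K.strategy_eq \<tau> unfolding AE_gauss_iff by (intro AE_lborel_affine) auto
  then have strategy: "AE v in lborel. \<phi> v = \<sigma> / \<tau> * (v - \<mu>)"
    by eventually_elim (use \<tau> \<sigma> in \<open>simp add: f_def field_simps\<close>)

  have f_T: "AE \<omega> in M. f (fst (T \<omega>)) = fst (T \<omega>)"
    by (rule AE_T[OF AE_gauss_pair_fst[OF K.strategy_eq]])
  then have Y_AE: "AE \<omega> in M. Y \<omega> = \<sigma> * (fst (T \<omega>) + snd (T \<omega>))"
    by eventually_elim (simp add: Y_eq T_def)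
  have pricing: "AE \<omega> in M. P (Y \<omega>) = \<mu> + \<tau> / (2 * \<sigma>) * Y \<omega>"
    using AE_T[OF K.pricing_eq] 
    by eventually_elim (use \<sigma> in \<open>simp add: T_def Y_eq P_eq\<close>)
  note a2 = gauss_pair_coordinates_square_integrable(1) and b2 = gauss_pair_coordinates_square_integrable(2)
  note ints = gauss2.integrable_if_square_integrable[OF a2] gauss2.integrable_if_square_integrable[OF b2]
    a2[unfolded square_integrable_def, THEN conjunct2] b2[unfolded square_integrable_def, THEN conjunct2]
    square_integrable_mult[OF a2 b2]
  have EY: "(\<integral>\<omega>. Y \<omega> \<partial>M) = 0"
  proof -
    have "(\<integral>\<omega>. Y \<omega> \<partial>M) = (\<integral>\<omega>. (\<lambda>w. \<sigma> * (fst w + snd w)) (T \<omega>) \<partial>M)"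
      using Y_AE by (intro integral_cong_AE) auto
    also have "\<dots> = 0"
      by (subst int_T) (use ints in \<open>simp_all add: gauss_pair_moments\<close>)
    finally show ?thesis .
  qed
  have EV: "(\<integral>\<omega>. V \<omega> \<partial>M) = \<mu>"
  proof -
    have "(\<integral>\<omega>. V \<omega> \<partial>M) = (\<integral>\<omega>. (\<lambda>w. \<mu> + \<tau> * fst w) (T \<omega>) \<partial>M)"
      by (simp add: V_eq T_def)
    also have "\<dots> = \<mu>"
      by (subst int_T) (use ints in \<open>simp_all add: gauss_pair_moments gauss2.prob_space\<close>)
    finally show ?thesis .
  qed
  have "covariance M V Y = (\<integral>\<omega>. (\<lambda>w. \<tau> * \<sigma> * ((fst w)\<^sup>2 + fst w * snd w)) (T \<omega>) \<partial>M)"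
    unfolding covariance_def EV EY
    by (rule integral_cong_AE)
      (use Y_AE in \<open>auto elim!: eventually_mono simp: V_eq T_def power2_eq_square algebra_simps\<close>)
  also have "\<dots> = \<tau> * \<sigma>"
    by (subst int_T) (use ints in \<open>simp_all add: gauss_pair_moments\<close>)
  finally have cov: "covariance M V Y = \<tau> * \<sigma>" .
  have "variance Y = (\<integral>\<omega>. (\<lambda>w. \<sigma>\<^sup>2 * ((fst w)\<^sup>2 + (snd w)\<^sup>2 + 2 * (fst w * snd w))) (T \<omega>) \<partial>M)"
    unfolding EY
    by (rule integral_cong_AE)
      (use Y_AE in \<open>auto elim!: eventually_mono simp: power2_eq_square algebra_simps\<close>)
  also have "\<dots> = \<sigma>\<^sup>2 * 2"
    by (subst int_T) (use ints in \<open>simp_all add: gauss_pair_moments\<close>)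
  finally have var: "variance Y = \<sigma>\<^sup>2 * 2" .
  have "covariance M V Y / variance Y = \<tau> / (2 * \<sigma>)"
    unfolding cov var using \<sigma> by (simp add: power2_eq_square)
  then show ?thesis
    using strategy pricing unfolding Let_def Y_def[symmetric] by simp
qed

end
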